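(* Let $\omega\in\mathfrak{M}_{m,n}(\mathbb{R})$ be a partial permutation. If $\omega$ is non-vexillary, then $X_\omega\subset\mathfrak{M}_{m,n}(\mathbb{R})$ is not a minimal submanifold (i.e. its mean curvature vector does not vanish identically).
   Context: $\mathfrak{M}_{m,n}(\mathbb{R})$ is the space of real $m\times n$ matrices with the inner product $\langle A,B\rangle=\mathrm{tr}(A^TB)$ (so it is isometric to $\mathbb{R}^{mn}$). A matrix $\omega\in\mathfrak{M}_{m,n}(\mathbb{R})$ is a partial permutation if each row and each column contains at most one entry equal to $1$ and all other entries are $0$. Extension: put $a_i=j$ if $\omega_{ij}=1$ for some $j$, and $a_i=\infty$ otherwise ($1\le i\le m$). The extension $\tilde\omega\in\mathfrak{S}_{m+n}$ is defined inductively by $\tilde\omega(i)=a_i$ if $i\le m$ and $a_i\le n$; $\tilde\omega(i)=\min([n+1,m+n]\setminus\{\tilde\omega(1),\dots,\tilde\omega(i-1)\})$ if $i\le m$ and $a_i=\infty$; $\tilde\omega(i)=\min([1,m+n]\setminus\{\tilde\omega(1),\dots,\tilde\omega(i-1)\})$ if $i>m$. Here $[a,b]=\{a,a+1,\dots,b\}$. $\omega$ is vexillary if $\tilde\omega$ avoids the pattern $2143$, i.e. there are no $i_1<i_2<i_3<i_4$ with $\tilde\omega(i_2)<\tilde\omega(i_1)<\tilde\omega(i_4)<\tilde\omega(i_3)$. For a matrix $A$, $A_{[p,q]}$ denotes its upper-left $p\times q$ submatrix. Define $X_\omega=\{A\in\mathfrak{M}_{m,n}(\mathbb{R}) : \mathrm{rk}(A_{[p,q]})=\mathrm{rk}(\omega_{[p,q]})\text{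 for all }1\le p\le m,\ 1\le q\le n\}$. It is a smooth submanifold of $\mathfrak{M}_{m,n}(\mathbb{R})$ (the orbit of $\omega$ under multiplication on the left by invertible lower triangular and on the right by invertible upper triangular matrices). A submanifold is minimal if its mean curvature vector vanishes at every point. *)

theory Defs
  imports "HOL-Analysis.Analysis"
begin

section \<open>Partial permutation matrices and their extensions\<close>

text \<open>
  Matrices have type \<open>real^'n^'m\<close>, where the row and column types are finite linear
  orders of cardinality \<open>m\<close> and \<open>n\<close>. The inner product of this type is the sum of the
  products of corresponding entries, that is \<open>tr (A\<^sup>T B)\<close>. The next function numbers the
  elements of an index type increasingly by \<open>1, 2, \<dots>\<close>.
\<close>

definition pos :: "'k::{finite,linorder} \<Rightarrow> nat" where
  "pos i = card {..i}"

definition partial_permutation :: "real^'n^'m \<Rightarrow> bool" where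
  "partial_permutation \<omega> \<longleftrightarrow>
     (\<forall>i j. \<omega> $ i $ j = 0 \<or> \<omega> $ i $ j = 1) \<and>
     (\<forall>i. \<exists>\<^sub>\<le>\<^sub>1 j. \<omega> $ i $ j = 1) \<and>
     (\<forall>j. \<exists>\<^sub>\<le>\<^sub>1 i. \<omega> $ i $ j = 1)"

text \<open>The number \<open>a\<^sub>i\<close>, with \<open>None\<close> in the role of \<open>\<infinity>\<close>.\<close>

definition row_value ::
    "real^('n::{finite,linorder})^('m::{finite,linorder}) \<Rightarrow> nat \<Rightarrow> nat option" where
  "row_value \<omega> i =
     (if \<exists>r c. pos r = i \<and> \<omega> $ r $ c = 1
      then Some (THE j. \<exists>r c. pos r = i \<and> pos c = j \<and> \<omega> $ r $ c = 1)
      else None)"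

function extension ::
    "real^('n::{finite,linorder})^('m::{finite,linorder}) \<Rightarrow> nat \<Rightarrow> nat" where
  "extension \<omega> i =
     (if i \<le> CARD('m) then
        (case row_value \<omega> i of
           Some j \<Rightarrow> j
         | None \<Rightarrow> Min ({CARD('n) + 1..CARD('m) + CARD('n)} - extension \<omega> ` {1..<i}))
      else Min ({1..CARD('m) + CARD('n)} - extension \<omega> ` {1..<i}))"
  by pat_completeness auto
termination
  by (relation "Wellfounded.measure snd") auto

declare extension.simps [simp del]

definition vexillary ::
    "real^('n::{finite,linorder})^('m::{finite,linorder}) \<Rightarrow> bool" where
  "vexillary \<omega> \<longleftrightarrow>
     \<not> (\<exists>i1 i2 i3 i4.
          1 \<le> i1 \<and> i1 < i2 \<and> i2 < i3 \<and> i3 < i4 \<and> i4 \<le> CARD('m) + CARD('n) \<and>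
          extension \<omega> i2 < extension \<omega> i1 \<and>
          extension \<omega> i1 < extension \<omega> i4 \<and>
          extension \<omega> i4 < extension \<omega> i3)"

section \<open>The submanifold defined by a partial permutation\<close>

text \<open>
  Matrix dimensions are types, so the upper-left \<open>p \<times> q\<close> submatrix is represented by padding
  it with zeros. This preserves the rank, see \<open>rank_upper_left\<close> below.
\<close>

definition upper_left ::
    "nat \<Rightarrow> nat \<Rightarrow> real^('n::{finite,linorder})^('m::{finite,linorder})
      \<Rightarrow> real^('n::{finite,linorder})^('m::{finite,linorder})" where
  "upper_left p q A = (\<chi> i j. if pos i \<le> p \<and> pos j \<le> q then A $ i $ j else 0)"

lemma rank_upper_left:
  fixes A :: "real^('n::{finite,linorder})^('m::{finite,linorder})"
    and f :: "'p::finite \<Rightarrow> 'm" and g :: "'q::finite \<Rightarrow> 'n"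
  assumes f: "inj f" "range f = {i. pos i \<le> p}"
    and g: "inj g" "range g = {j. pos j \<le> q}"
  shows "rank (upper_left p q A) = rank ((\<chi> i j. A $ f i $ g j) :: real^'q^'p)"
proof -
  define B :: "real^'q^'p" where "B = (\<chi> i j. A $ f i $ g j)"
  define F :: "real^'p^('m::{finite,linorder})" where "F = (\<chi> r i. if r = f i then 1 else 0)"
  define G :: "real^('n::{finite,linorder})^'q" where "G = (\<chi> j c. if c = g j then 1 else 0)"
  have delta: "(\<Sum>k\<in>UNIV. (if k = a then 1 else 0) * h k) = h a"
              "(\<Sum>k\<in>UNIV. h k * (if k = a then 1 else 0)) = h a"
    for a :: "'k::finite" and h :: "'k \<Rightarrow> real"
    by (simp_all add: if_distrib[of "\<lambda>x. x * _"] if_distrib[of "\<lambda>x. _ * x"] cong: if_cong)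
  have pf: "pos (f i) \<le> p" for i using f(2) by auto
  have pg: "pos (g j) \<le> q" for j using g(2) by auto
  have FB: "(F ** B) $ r $ j = (if pos r \<le> p then A $ r $ g j else 0)" for r j
  proof (cases "pos r \<le> p")
    case True
    then obtain i where i: "r = f i" using f(2) by blast
    have "(F ** B) $ r $ j = (\<Sum>k\<in>UNIV. (if k = i then 1 else 0) * B $ k $ j)"
      unfolding matrix_matrix_mult_def F_def i by (simp add: inj_eq[OF f(1)] eq_commute[of i])
    also have "\<dots> = B $ i $ j"
      by (rule delta)
    finally show ?thesis using True by (simp add: B_def i)
  next
    case False
    then have "r \<noteq> f i" for i using pf by auto
    then show ?thesis using False by (simp add: matrix_matrix_mult_def F_def)
  qed
  have U: "upper_left p q A = F ** B ** G"
  proof -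
    have "(F ** B ** G) $ r $ c = upper_left p q A $ r $ c" for r c
    proof (cases "pos c \<le> q")
      case True
      then obtain j where j: "c = g j" using g(2) by blast
      have "(F ** B ** G) $ r $ c = (\<Sum>k\<in>UNIV. (F ** B) $ r $ k * G $ k $ c)"
        by (simp add: matrix_matrix_mult_def)
      also have "\<dots> = (\<Sum>k\<in>UNIV. (F ** B) $ r $ k * (if k = j then 1 else 0))"
        unfolding G_def j by (simp add: inj_eq[OF g(1)] eq_commute[of j])
      also have "\<dots> = (F ** B) $ r $ j"
        by (rule delta)
      finally show ?thesis using True by (simp add: FB upper_left_def j)
    next
      case False
      then have "c \<noteq> g j" for j using pg by auto
      then show ?thesis using False by (simp add: matrix_matrix_mult_def G_def upper_left_def)
    qed
    then show ?thesis by (simp add: vec_eq_iff)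
  qed
  have B: "B = transpose F ** upper_left p q A ** transpose G"
  proof -
    have 1: "(transpose F ** upper_left p q A) $ i $ c = upper_left p q A $ f i $ c" for i c
      by (simp add: matrix_matrix_mult_def transpose_def F_def delta)
    have "(transpose F ** upper_left p q A ** transpose G) $ i $ j
        = (\<Sum>k\<in>UNIV. (transpose F ** upper_left p q A) $ i $ k * transpose G $ k $ j)" for i j
      by (simp add: matrix_matrix_mult_def)
    moreover have "transpose G $ k $ j = (if k = g j then 1 else 0)" for k j
      by (simp add: transpose_def G_def)
    ultimately have "(transpose F ** upper_left p q A ** transpose G) $ i $ j
        = upper_left p q A $ f i $ g j" for i j
      by (simp only: 1 delta)
    then show ?thesis using pf pg by (simp add: vec_eq_iff B_def upper_left_def)
  qed
  have "rank (upper_left p q A) \<le> rank B"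
    unfolding U by (meson order_trans rank_mul_le_left rank_mul_le_right)
  moreover have "rank B \<le> rank (upper_left p q A)"
    by (subst B) (meson order_trans rank_mul_le_left rank_mul_le_right)
  ultimately show ?thesis unfolding B_def by simp
qed

definition rank_stratum ::
    "real^('n::{finite,linorder})^('m::{finite,linorder})
      \<Rightarrow> (real^('n::{finite,linorder})^('m::{finite,linorder})) set" where
  "rank_stratum \<omega> =
     {A. \<forall>p\<in>{1..CARD('m)}. \<forall>q\<in>{1..CARD('n)}.
           rank (upper_left p q A) = rank (upper_left p q \<omega>)}"

section \<open>Mean curvature of a submanifold of a Euclidean space\<close>

text \<open>
  The notions of this section are meant for smooth submanifolds \<open>M\<close> of the Euclidean space
  \<open>'a\<close>; smoothness on a set is only used for open sets.
\<close>

primrec diff_times_on ::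
    "nat \<Rightarrow> 'a::real_normed_vector set \<Rightarrow> ('a \<Rightarrow> 'b::real_normed_vector) \<Rightarrow> bool" where
  "diff_times_on 0 S f \<longleftrightarrow> continuous_on S f"
| "diff_times_on (Suc k) S f \<longleftrightarrow>
     (\<forall>x\<in>S. f differentiable (at x)) \<and>
     (\<forall>v. diff_times_on k S (\<lambda>x. frechet_derivative f (at x) v))"

definition smooth_on ::
    "'a::real_normed_vector set \<Rightarrow> ('a \<Rightarrow> 'b::real_normed_vector) \<Rightarrow> bool" where
  "smooth_on S f \<longleftrightarrow> (\<forall>k. diff_times_on k S f)"

definition tangent_space :: "'a::euclidean_space set \<Rightarrow> 'a \<Rightarrow> 'a set" where
  "tangent_space M x =
     {v. \<exists>\<gamma> \<epsilon>. 0 < \<epsilon> \<and> smooth_on {-\<epsilon><..<\<epsilon>} \<gamma> \<and> \<gamma> ` {-\<epsilon><..<\<epsilon>} \<subseteq> M \<and>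
              \<gamma> 0 = x \<and> (\<gamma> has_vector_derivative v) (at 0)}"

definition normal_component :: "'a::euclidean_space set \<Rightarrow> 'a \<Rightarrow> 'a" where
  "normal_component T w = (THE z. z \<in> orthogonal_comp T \<and> w - z \<in> T)"

text \<open>
  A smooth local tangent field near \<open>x\<close>, given through an extension to a neighbourhood of \<open>x\<close>
  in the ambient space.
\<close>

definition local_tangent_field :: "'a::euclidean_space set \<Rightarrow> 'a \<Rightarrow> ('a \<Rightarrow> 'a) \<Rightarrow> bool" where
  "local_tangent_field M x V \<longleftrightarrow>
     (\<exists>U. open U \<and> x \<in> U \<and> smooth_on U V \<and> (\<forall>y\<in>M \<inter> U. V y \<in> tangent_space M y))"

text \<open>
  The second fundamental form \<open>II(u, v) = (D\<^sub>u V)\<^sup>\<bottom>\<close>, where \<open>V\<close> is any local tangent field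
  with \<open>V(x) = v\<close>; on a submanifold the value does not depend on the choice of \<open>V\<close>.
\<close>

definition second_fundamental_form :: "'a::euclidean_space set \<Rightarrow> 'a \<Rightarrow> 'a \<Rightarrow> 'a \<Rightarrow> 'a" where
  "second_fundamental_form M x u v =
     (THE w. \<exists>V. local_tangent_field M x V \<and> V x = v \<and>
        w = normal_component (tangent_space M x) (frechet_derivative V (at x) u))"

definition orthonormal_basis_of :: "'a::euclidean_space set \<Rightarrow> 'a set \<Rightarrow> bool" where
  "orthonormal_basis_of T B \<longleftrightarrow>
     pairwise orthogonal B \<and> (\<forall>b\<in>B. norm b = 1) \<and> span B = T"

text \<open>
  The trace of the second fundamental form. Some authors divide it by the dimension of \<open>M\<close>,
  which does not affect its vanishing.
\<close>

definition mean_curvature_vector :: "'a::euclidean_space set \<Rightarrow> 'a \<Rightarrow> 'a" where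
  "mean_curvature_vector M x =
     (\<Sum>e\<in>(SOME B. orthonormal_basis_of (tangent_space M x) B).
        second_fundamental_form M x e e)"

end

theory Submission
  imports Defs
begin

text \<open>
  The stratum is an orbit of triangular matrices with tangent spaces \<open>{L A + A R}\<close>, and
  \<open>y \<mapsto> L y + y R\<close> is a global tangent field on it, so \<open>\<langle>N, II(e, e)\<rangle> = 2 \<langle>N, L A R\<rangle>\<close> for
  \<open>e = L A + A R\<close> and every normal \<open>N\<close>. A pattern \<open>2143\<close> gives two ones \<open>(i\<^sub>1, b)\<close>, \<open>(i\<^sub>2, a)\<close> of
  \<open>\<omega>\<close> with \<open>i\<^sub>1 < i\<^sub>2\<close>, \<open>a < b\<close>, and a cell \<open>(p, q)\<close> south-east of both which has no one weakly to
  the left in its row or weakly above in its column. At \<open>\<omega>\<close> itself the mean curvature vanishes;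
  instead let \<open>A\<close> arise from \<open>\<omega>\<close> by adding row \<open>i\<^sub>1\<close> to row \<open>p\<close> and the columns \<open>a\<close>, \<open>b\<close> to
  column \<open>q\<close>. For the normal \<open>N = n \<mu>\<^sup>T\<close> with \<open>n = e\<^sub>p - e\<^sub>i\<^sub>1\<close> and \<open>\<mu> = e\<^sub>q - e\<^sub>b - e\<^sub>a\<close>,
  \<open>\<langle>N, II(e, e)\<rangle>\<close> is twice the sum of \<open>\<langle>e, n e\<^sub>j\<^sup>T\<rangle> \<langle>e, e\<^sub>k \<mu>\<^sup>T\<rangle>\<close> over the ones \<open>(k, j)\<close> of \<open>\<omega>\<close>
  north-west of \<open>(p, q)\<close>. Taking the trace over the tangent space projects \<open>n e\<^sub>j\<^sup>T\<close> to it; only the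
  one \<open>(i\<^sub>1, b)\<close> contributes, and \<open>\<langle>N, H\<rangle> = 2/5\<close>.
\<close>

section \<open>The numbering of an index type\<close>

lemma pos_le_iff: "pos i \<le> pos j \<longleftrightarrow> i \<le> j"
proof
  assume "i \<le> j"
  then show "pos i \<le> pos j"
    unfolding pos_def by (intro card_mono) auto
next
  assume *: "pos i \<le> pos j"
  show "i \<le> j"
  proof (rule ccontr)
    assume "\<not> i \<le> j"
    then have "{..j} \<subset> {..i}" by auto
    then have "pos j < pos i"
      unfolding pos_def by (intro psubset_card_mono) auto
    then show False using * by simp
  qed
qed

lemma pos_less_iff: "pos i < pos j \<longleftrightarrow> i < j"
  using pos_le_iff[of j i] by auto

lemma pos_eq_iff: "pos i = pos j \<longleftrightarrow> i = j"
  by (metis order_antisym order_refl pos_le_iff)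

lemma pos_bounds: "1 \<le> pos i" "pos i \<le> CARD('k)" for i :: "'k::{finite,linorder}"
proof -
  have "pos i \<noteq> 0" unfolding pos_def by (auto simp: card_eq_0_iff)
  then show "1 \<le> pos i" by simp
  show "pos i \<le> CARD('k)" unfolding pos_def by (rule card_mono) auto
qed

lemma pos_range: "range (pos :: 'k::{finite,linorder} \<Rightarrow> nat) = {1..CARD('k)}"
proof (rule card_subset_eq)
  show "range (pos :: 'k \<Rightarrow> nat) \<subseteq> {1..CARD('k)}" using pos_bounds by auto
  have "inj (pos :: 'k \<Rightarrow> nat)" by (auto simp: inj_def pos_eq_iff)
  then show "card (range (pos :: 'k \<Rightarrow> nat)) = card {1..CARD('k)}" by (simp add: card_image)
qed simp

lemma pos_surj: "1 \<le> p \<Longrightarrow> p \<le> CARD('k) \<Longrightarrow> \<exists>i::'k::{finite,linorder}. pos i = p"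
  using pos_range[where 'k='k] by (metis atLeastAtMost_iff imageE)

section \<open>The extension of a partial permutation\<close>

context
  fixes \<omega> :: "real^('n::{finite,linorder})^('m::{finite,linorder})"
  assumes \<omega>: "partial_permutation \<omega>"
begin

lemma partial_permutation_row: "\<omega> $ i $ j = 1 \<Longrightarrow> \<omega> $ i $ j' = 1 \<Longrightarrow> j = j'"
  using \<omega> unfolding partial_permutation_def Uniq_def by blast

lemma partial_permutation_col: "\<omega> $ i $ j = 1 \<Longrightarrow> \<omega> $ i' $ j = 1 \<Longrightarrow> i = i'"
  using \<omega> unfolding partial_permutation_def Uniq_def by blast

lemma partial_permutation_entry: "\<omega> $ i $ j = 0 \<or> \<omega> $ i $ j = 1"
  using \<omega> unfolding partial_permutation_def by blast

lemma row_value_Some: "\<omega> $ r $ c = 1 \<Longrightarrow> row_value \<omega> (pos r) = Some (pos c)"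
proof -
  assume *: "\<omega> $ r $ c = 1"
  have "(THE j. \<exists>r' c. pos r' = pos r \<and> pos c = j \<and> \<omega> $ r' $ c = 1) = pos c"
    using * by (intro the_equality) (auto simp: pos_eq_iff dest: partial_permutation_row)
  then show ?thesis using * unfolding row_value_def by auto
qed

lemma row_value_None: "(\<And>c. \<omega> $ r $ c \<noteq> 1) \<Longrightarrow> row_value \<omega> (pos r) = None"
  unfolding row_value_def by (auto simp: pos_eq_iff)

lemma extension_one:
  assumes "\<omega> $ r $ c = 1"
  shows "extension \<omega> (pos r) = pos c"
  using row_value_Some[OF assms] pos_bounds(2)[of r]
  by (subst extension.simps) simp

lemma extension_empty_row:
  assumes "\<And>c. \<omega> $ r $ c \<noteq> 1"
  shows "extension \<omega> (pos r) =
    Min ({CARD('n) + 1..CARD('m) + CARD('n)} - extension \<omega> ` {1..<pos r})"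
  using row_value_None[OF assms] pos_bounds(2)[of r]
  by (subst extension.simps) simp

lemma extension_beyond:
  assumes "CARD('m) < i"
  shows "extension \<omega> i = Min ({1..CARD('m) + CARD('n)} - extension \<omega> ` {1..<i})"
  using assms by (subst extension.simps) simp

text \<open>Pigeonhole: the interval has \<open>b + 1 - a\<close> elements, hence at least
  \<open>i\<close>, and the image at most \<open>i - 1\<close>. So the minima in
  \<open>extension\<close> are taken over nonempty sets.\<close>

lemma interval_minus_image_nonempty:
  fixes a b i :: nat and f :: "nat \<Rightarrow> nat"
  assumes "a + i \<le> b + 1" "1 \<le> i"
  shows "{a + 1..b + 1} - f ` {1..<i} \<noteq> {}"
proof
  assume "{a + 1..b + 1} - f ` {1..<i} = {}"
  then have "{a + 1..b + 1} \<subseteq> f ` {1..<i}" by blast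
  then have "card {a + 1..b + 1} \<le> card {1..<i}"
    by (meson card_mono card_image_le finite_atLeastLessThan finite_imageI order_trans)
  then show False using assms by simp
qed

lemma extension_empty_row_in:
  assumes "\<And>c. \<omega> $ r $ c \<noteq> 1"
  shows "extension \<omega> (pos r) \<in> {CARD('n) + 1..CARD('m) + CARD('n)} - extension \<omega> ` {1..<pos r}"
proof -
  let ?S = "{CARD('n) + 1..CARD('m) + CARD('n)} - extension \<omega> ` {1..<pos r}"
  have "{CARD('n) + 1..(CARD('m) + CARD('n) - 1) + 1} - extension \<omega> ` {1..<pos r} \<noteq> {}"
    using pos_bounds[of r] by (intro interval_minus_image_nonempty) auto
  then have "?S \<noteq> {}" using zero_less_card_finite[where 'a='m] by simp
  then have "Min ?S \<in> ?S" by (intro Min_in) auto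
  then show ?thesis using extension_empty_row[OF assms] by simp
qed

lemma extension_beyond_in:
  assumes "CARD('m) < i" "i \<le> CARD('m) + CARD('n)"
  shows "extension \<omega> i \<in> {1..CARD('m) + CARD('n)} - extension \<omega> ` {1..<i}"
proof -
  let ?S = "{1..CARD('m) + CARD('n)} - extension \<omega> ` {1..<i}"
  have "{0 + 1..(CARD('m) + CARD('n) - 1) + 1} - extension \<omega> ` {1..<i} \<noteq> {}"
    using assms by (intro interval_minus_image_nonempty) auto
  then have "?S \<noteq> {}" using zero_less_card_finite[where 'a='m] by simp
  then have "Min ?S \<in> ?S" by (intro Min_in) auto
  then show ?thesis using extension_beyond[OF assms(1)] by simp
qed

text \<open>Empty rows receive values above \<open>CARD('n)\<close>, so a smaller value at a row
  position stems from a one.\<close>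

lemma extension_le_cardD:
  assumes "1 \<le> i" "i \<le> CARD('m)" "extension \<omega> i \<le> CARD('n)"
  obtains r c where "pos r = i" "pos c = extension \<omega> i" "\<omega> $ r $ c = 1"
proof -
  obtain r :: 'm where r: "pos r = i" using pos_surj assms by blast
  have "\<exists>c. \<omega> $ r $ c = 1"
  proof (rule ccontr)
    assume "\<nexists>c. \<omega> $ r $ c = 1"
    then have "extension \<omega> (pos r) \<ge> CARD('n) + 1" using extension_empty_row_in[of r] by auto
    then show False using assms r by simp
  qed
  then show ?thesis using that r extension_one by metis
qed

lemma extension_notin_earlier:
  assumes "1 \<le> i" "i \<le> CARD('m) + CARD('n)"
    and "CARD('m) < i \<or> CARD('n) < extension \<omega> i"
  shows "extension \<omega> i \<notin> extension \<omega> ` {1..<i}"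
proof (cases "CARD('m) < i")
  case True
  then show ?thesis using extension_beyond_in[of i] assms by blast
next
  case False
  then obtain r :: 'm where r: "pos r = i" using pos_surj[where 'k='m, of i] assms by auto
  have "\<omega> $ r $ c \<noteq> 1" for c
    using extension_one[of r c] pos_bounds(2)[of c] assms False r by auto
  then show ?thesis using extension_empty_row_in[of r] r by blast
qed

text \<open>
  Since the extension is increasing where it is not given by \<open>\<omega>\<close>, the last two letters of a
  pattern \<open>2143\<close> span a cell \<open>(p, q)\<close> inside the matrix.
\<close>

lemma nonvexillaryE:
  assumes "\<not> vexillary \<omega>"
  obtains i\<^sub>1 i\<^sub>2 p a b q where
    "i\<^sub>1 < i\<^sub>2" "i\<^sub>2 < p" "a < b" "b < q" "\<omega> $ i\<^sub>1 $ b = 1" "\<omega> $ i\<^sub>2 $ a = 1"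
    "\<And>j. j \<le> q \<Longrightarrow> \<omega> $ p $ j = 0" "\<And>i. i \<le> p \<Longrightarrow> \<omega> $ i $ q = 0"
proof -
  let ?m = "CARD('m)" and ?n = "CARD('n)" and ?w = "extension \<omega>"
  obtain i1 i2 i3 i4 where i: "1 \<le> i1" "i1 < i2" "i2 < i3" "i3 < i4" "i4 \<le> ?m + ?n"
    and w: "?w i2 < ?w i1" "?w i1 < ?w i4" "?w i4 < ?w i3"
    using assms unfolding vexillary_def by blast
  have w4: "?w i4 \<notin> ?w ` {1..<i4}" if "?m < i4 \<or> ?n < ?w i4"
    using extension_notin_earlier[of i4] i that by simp
  \<comment> \<open>Otherwise \<open>i3\<close> takes the least free number, but the smaller value
    of \<open>i4\<close> is still free then.\<close>
  have i3: "i3 \<le> ?m"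
  proof (rule ccontr)
    assume "\<not> i3 \<le> ?m"
    then have m: "?m < i3" by simp
    have "?w i4 \<in> {1..?m + ?n} - ?w ` {1..<i4}" using extension_beyond_in m i by simp
    then have "?w i4 \<in> {1..?m + ?n} - ?w ` {1..<i3}" using i by auto
    then have "?w i3 \<le> ?w i4" using extension_beyond[OF m] by simp
    then show False using w by simp
  qed
  \<comment> \<open>Otherwise \<open>i3\<close> is an empty row and takes the least free number
    above \<open>CARD('n)\<close>, but the smaller value of \<open>i4\<close> is such a number
    too.\<close>
  have n4: "?w i4 \<le> ?n"
  proof (rule ccontr)
    assume n: "\<not> ?w i4 \<le> ?n"
    obtain r :: 'm where r: "pos r = i3" using pos_surj[of i3] i i3 by auto
    have empty: "\<omega> $ r $ c \<noteq> 1" for c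
      using extension_one[of r c] pos_bounds(2)[of c] w n r by auto
    have "?w i4 \<le> ?m + ?n" using extension_empty_row_in[OF empty] w r by auto
    then have "?w i4 \<in> {?n + 1..?m + ?n} - ?w ` {1..<i3}" using w4 n i by auto
    then have "?w i3 \<le> ?w i4" using extension_empty_row[OF empty] r by simp
    then show False using w by simp
  qed
  obtain r1 c1 where 1: "pos r1 = i1" "pos c1 = ?w i1" "\<omega> $ r1 $ c1 = 1"
    using extension_le_cardD[of i1] i i3 w n4 by auto
  obtain r2 c2 where 2: "pos r2 = i2" "pos c2 = ?w i2" "\<omega> $ r2 $ c2 = 1"
    using extension_le_cardD[of i2] i i3 w n4 by auto
  obtain p :: 'm where p: "pos p = i3" using pos_surj[of i3] i i3 by auto
  obtain q :: 'n where q: "pos q = ?w i4" using pos_surj[of "?w i4"] w n4 by auto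
  show thesis
  proof (rule that[of r1 r2 p c2 c1 q])
    show "r1 < r2" "r2 < p" "c2 < c1" "c1 < q"
      using 1 2 p q i w by (simp_all flip: pos_less_iff)
    show "\<omega> $ r1 $ c1 = 1" "\<omega> $ r2 $ c2 = 1" by fact+
    show "\<omega> $ p $ j = 0" if "j \<le> q" for j
      using partial_permutation_entry[of p j] extension_one[of p j] that w p q
      by (auto simp flip: pos_le_iff)
    \<comment> \<open>A one in column \<open>q\<close> would give the value of \<open>i4\<close>
      already at position \<open>pos i < i4\<close>. Past the rows \<open>extension\<close> repeats
      no value; otherwise row \<open>i4\<close> would hold a second one of that column.\<close>
    show "\<omega> $ i $ q = 0" if "i \<le> p" for i
    proof (rule ccontr)
      assume "\<omega> $ i $ q \<noteq> 0"
      then have one: "\<omega> $ i $ q = 1" using partial_permutation_entry[of i q] by simp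
      have lt: "pos i < i4" using that p \<open>i3 < i4\<close> by (simp flip: pos_le_iff)
      show False
      proof (cases "?m < i4")
        case True
        have "?w (pos i) = ?w i4" using extension_one[OF one] q by simp
        then have "?w i4 \<in> ?w ` {1..<i4}" using lt pos_bounds(1)[of i]
          by (metis atLeastLessThan_iff image_eqI)
        then show False using w4 True by simp
      next
        case False
        then obtain r c where rc: "pos r = i4" "pos c = ?w i4" "\<omega> $ r $ c = 1"
          using extension_le_cardD[of i4] n4 i by auto
        then have "c = q" using q by (simp flip: pos_eq_iff)
        then show False using one rc lt partial_permutation_col[of i q r] by auto
      qed
    qed
  qed
qed

end

section \<open>Triangular matrices acting on the rank strata\<close>

definition lower_triangular :: "real^('k::{finite,linorder})^('k::{finite,linorder}) \<Rightarrow> bool" where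
  "lower_triangular L \<longleftrightarrow> (\<forall>i j. i < j \<longrightarrow> L $ i $ j = 0)"

definition upper_triangular :: "real^('k::{finite,linorder})^('k::{finite,linorder}) \<Rightarrow> bool" where
  "upper_triangular R \<longleftrightarrow> (\<forall>i j. j < i \<longrightarrow> R $ i $ j = 0)"

text \<open>Asking for a triangular inverse makes these matrices a group at once;
  \<open>lower_unitI\<close> obtains the inverse from a nonzero diagonal.\<close>

definition lower_unit :: "real^('k::{finite,linorder})^('k::{finite,linorder}) \<Rightarrow> bool" where
  "lower_unit P \<longleftrightarrow> lower_triangular P \<and>
     (\<exists>P'. lower_triangular P' \<and> P ** P' = mat 1 \<and> P' ** P = mat 1)"

definition upper_unit :: "real^('k::{finite,linorder})^('k::{finite,linorder}) \<Rightarrow> bool" where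
  "upper_unit Q \<longleftrightarrow> upper_triangular Q \<and>
     (\<exists>Q'. upper_triangular Q' \<and> Q ** Q' = mat 1 \<and> Q' ** Q = mat 1)"

lemma matrix_mult_nth: "(A ** B) $ i $ j = (\<Sum>k\<in>UNIV. A $ i $ k * B $ k $ j)"
  by (simp add: matrix_matrix_mult_def)

lemma upper_triangular_transpose: "upper_triangular (transpose A) \<longleftrightarrow> lower_triangular A"
  and lower_triangular_transpose: "lower_triangular (transpose A) \<longleftrightarrow> upper_triangular A"
  unfolding upper_triangular_def lower_triangular_def transpose_def by auto

lemma lower_triangular_mult:
  assumes "lower_triangular A" "lower_triangular B"
  shows "lower_triangular (A ** B)"
  unfolding lower_triangular_def
proof (intro allI impI)
  fix i j :: 'a assume "i < j"
  then have "A $ i $ k * B $ k $ j = 0" for k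
    using assms by (cases "i < k") (auto simp: lower_triangular_def)
  then show "(A ** B) $ i $ j = 0" unfolding matrix_mult_nth by (rule sum.neutral[OF ballI])
qed

lemma upper_triangular_mult:
  "upper_triangular A \<Longrightarrow> upper_triangular B \<Longrightarrow> upper_triangular (A ** B)"
  using lower_triangular_mult[of "transpose B" "transpose A"]
  by (simp add: lower_triangular_transpose flip: matrix_transpose_mul)

lemma lower_triangular_linear:
  "lower_triangular A \<Longrightarrow> lower_triangular B \<Longrightarrow> lower_triangular (A + B)"
  "lower_triangular A \<Longrightarrow> lower_triangular (c *\<^sub>R A)"
  "lower_triangular 0" "lower_triangular (mat c)"
  unfolding lower_triangular_def mat_def by auto

lemma upper_triangular_linear:
  "upper_triangular A \<Longrightarrow> upper_triangular B \<Longrightarrow> upper_triangular (A + B)"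
  "upper_triangular A \<Longrightarrow> upper_triangular (c *\<^sub>R A)"
  "upper_triangular 0" "upper_triangular (mat c)"
  unfolding upper_triangular_def mat_def by auto

text \<open>Forward substitution: at the least \<open>k\<close> with \<open>x $ k\<close> nonzero,
  row \<open>k\<close> of the system reduces to its diagonal term. As \<open>S\<close> is an initial
  segment, only its equations are used: \<open>UNIV\<close> gives injectivity, \<open>{..<j}\<close>
  a triangular inverse.\<close>

lemma lower_triangular_solution_zero:
  assumes P: "lower_triangular P" "\<And>i. P $ i $ i \<noteq> 0"
    and S: "\<And>i j. i \<in> S \<Longrightarrow> j \<le> i \<Longrightarrow> j \<in> S"
    and Px: "\<And>i. i \<in> S \<Longrightarrow> (P *v x) $ i = 0"
    and i: "i \<in> S"
  shows "x $ i = 0"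
proof (rule ccontr)
  define k where "k = Min {i. x $ i \<noteq> 0}"
  assume "x $ i \<noteq> 0"
  then have k: "x $ k \<noteq> 0" "k \<le> i"
    unfolding k_def using Min_in[of "{i. x $ i \<noteq> 0}"] by auto
  have "P $ k $ j * x $ j = 0" if "j \<noteq> k" for j
  proof (cases "j < k")
    case True
    have "k \<le> j" if "x $ j \<noteq> 0" unfolding k_def by (rule Min_le) (use that in auto)
    then show ?thesis using True by auto
  next
    case False
    then show ?thesis using that P(1) unfolding lower_triangular_def by auto
  qed
  then have "(P *v x) $ k = P $ k $ k * x $ k"
    unfolding matrix_vector_mult_def by (simp add: sum.remove[of _ k] sum.neutral del: mult_eq_0_iff)
  then show False using k P(2) Px[of k] S[OF i] by auto
qed

lemma lower_unitI:
  assumes P: "lower_triangular P" "\<And>i. P $ i $ i \<noteq> 0"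
  shows "lower_unit P"
proof -
  have "x = 0" if "P *v x = 0" for x
    using lower_triangular_solution_zero[OF P, where S=UNIV and x=x] that by (simp add: vec_eq_iff)
  then obtain P' where 1: "P' ** P = mat 1" using matrix_left_invertible_ker[of P] by blast
  then have 2: "P ** P' = mat 1" using matrix_left_right_inverse by blast
  \<comment> \<open>Column \<open>j\<close> of \<open>P'\<close> solves a system whose right-hand
    side vanishes above place \<open>j\<close>.\<close>
  have "P' $ i $ j = 0" if "i < j" for i j
  proof -
    have "P *v (P' *v axis j 1) = axis j 1" by (simp add: matrix_vector_mul_assoc 2)
    then have "(P' *v axis j 1) $ i = 0"
      using lower_triangular_solution_zero[OF P, where S="{..<j}" and x="P' *v axis j 1" and i=i] that
      by (simp add: axis_def)
    then show ?thesis by (simp add: matrix_vector_mul_component inner_axis)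
  qed
  then show ?thesis using 1 2 P unfolding lower_unit_def lower_triangular_def by blast
qed

lemma upper_unitI:
  assumes "upper_triangular Q" "\<And>i. Q $ i $ i \<noteq> 0"
  shows "upper_unit Q"
proof -
  have "lower_unit (transpose Q)"
  proof (rule lower_unitI)
    show "lower_triangular (transpose Q)" using assms(1) by (simp add: lower_triangular_transpose)
    show "transpose Q $ i $ i \<noteq> 0" for i using assms(2) by (simp add: transpose_def)
  qed
  then obtain Q' where Q': "lower_triangular Q'" "transpose Q ** Q' = mat 1" "Q' ** transpose Q = mat 1"
    unfolding lower_unit_def by blast
  then have "Q ** transpose Q' = mat 1" "transpose Q' ** Q = mat 1"
    by (metis matrix_transpose_mul transpose_mat transpose_transpose)+
  then show ?thesis using assms(1) Q'(1) unfolding upper_unit_def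
    by (metis upper_triangular_transpose)
qed

lemma lower_unit_mult:
  assumes "lower_unit P" "lower_unit P\<^sub>2"
  shows "lower_unit (P ** P\<^sub>2)"
proof -
  obtain P' P2' where
    "lower_triangular P'" "P ** P' = mat 1" "P' ** P = mat 1"
    "lower_triangular P2'" "P\<^sub>2 ** P2' = mat 1" "P2' ** P\<^sub>2 = mat 1"
    using assms unfolding lower_unit_def by blast
  moreover from this have "(P ** P\<^sub>2) ** (P2' ** P') = mat 1" "(P2' ** P') ** (P ** P\<^sub>2) = mat 1"
    by (metis matrix_mul_assoc matrix_mul_lid)+
  ultimately show ?thesis using assms unfolding lower_unit_def
    by (meson lower_triangular_mult)
qed

lemma upper_unit_mult:
  assumes "upper_unit Q" "upper_unit Q\<^sub>2"
  shows "upper_unit (Q ** Q\<^sub>2)"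
proof -
  obtain Q' Q2' where
    "upper_triangular Q'" "Q ** Q' = mat 1" "Q' ** Q = mat 1"
    "upper_triangular Q2'" "Q\<^sub>2 ** Q2' = mat 1" "Q2' ** Q\<^sub>2 = mat 1"
    using assms unfolding upper_unit_def by blast
  moreover from this have "(Q ** Q\<^sub>2) ** (Q2' ** Q') = mat 1" "(Q2' ** Q') ** (Q ** Q\<^sub>2) = mat 1"
    by (metis matrix_mul_assoc matrix_mul_lid)+
  ultimately show ?thesis using assms unfolding upper_unit_def
    by (meson upper_triangular_mult)
qed

text \<open>Near 0 the diagonal entries stay nonzero. This line through the identity replaces the
  matrix exponential and keeps all curves polynomial.\<close>

lemma eventually_lower_unit:
  assumes "lower_triangular L"
  shows "eventually (\<lambda>t. lower_unit (mat 1 + t *\<^sub>R L)) (nhds 0)"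
proof -
  have "eventually (\<lambda>t. 1 + t * L $ i $ i \<noteq> 0) (nhds 0)" for i
  proof -
    have "((\<lambda>t. 1 + t * L $ i $ i) \<longlongrightarrow> 1 + 0 * L $ i $ i) (nhds 0)"
      by (intro tendsto_intros filterlim_ident)
    then show ?thesis using tendsto_imp_eventually_ne by fastforce
  qed
  then have "eventually (\<lambda>t. \<forall>i. 1 + t * L $ i $ i \<noteq> 0) (nhds 0)"
    by (rule eventually_all_finite)
  then show ?thesis
  proof eventually_elim
    case (elim t)
    show ?case
      by (intro lower_unitI lower_triangular_linear assms) (use elim in \<open>simp add: mat_def\<close>)
  qed
qed

lemma eventually_upper_unit:
  assumes "upper_triangular R"
  shows "eventually (\<lambda>t. upper_unit (mat 1 + t *\<^sub>R R)) (nhds 0)"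
proof -
  have "eventually (\<lambda>t. 1 + t * R $ i $ i \<noteq> 0) (nhds 0)" for i
  proof -
    have "((\<lambda>t. 1 + t * R $ i $ i) \<longlongrightarrow> 1 + 0 * R $ i $ i) (nhds 0)"
      by (intro tendsto_intros filterlim_ident)
    then show ?thesis using tendsto_imp_eventually_ne by fastforce
  qed
  then have "eventually (\<lambda>t. \<forall>i. 1 + t * R $ i $ i \<noteq> 0) (nhds 0)"
    by (rule eventually_all_finite)
  then show ?thesis
  proof eventually_elim
    case (elim t)
    show ?case
      by (intro upper_unitI upper_triangular_linear assms) (use elim in \<open>simp add: mat_def\<close>)
  qed
qed

text \<open>Row \<open>i\<close> of the product uses only rows of \<open>A\<close> up to
  \<open>i\<close>, so truncation is multiplicative. This is why the action preserves the corner
  ranks.\<close>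

lemma upper_left_lower_triangular_mult:
  assumes "lower_triangular P"
  shows "upper_left p q (P ** A) = upper_left p p P ** upper_left p q A"
proof -
  have "P $ i $ k * A $ k $ j = upper_left p p P $ i $ k * upper_left p q A $ k $ j"
    if "pos i \<le> p" "pos j \<le> q" for i j k
    using that assms pos_le_iff[of k i]
    by (cases "k \<le> i") (auto simp: upper_left_def lower_triangular_def)
  then show ?thesis
    unfolding vec_eq_iff matrix_mult_nth
    by (auto simp: upper_left_def matrix_mult_nth intro!: sum.cong sum.neutral)
qed

lemma upper_left_upper_triangular_mult:
  assumes "upper_triangular Q"
  shows "upper_left p q (A ** Q) = upper_left p q A ** upper_left q q Q"
proof -
  have "A $ i $ k * Q $ k $ j = upper_left p q A $ i $ k * upper_left q q Q $ k $ j"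
    if "pos i \<le> p" "pos j \<le> q" for i j k
    using that assms pos_le_iff[of k j]
    by (cases "k \<le> j") (auto simp: upper_left_def upper_triangular_def)
  then show ?thesis
    unfolding vec_eq_iff matrix_mult_nth
    by (auto simp: upper_left_def matrix_mult_nth intro!: sum.cong sum.neutral)
qed

lemma rank_upper_left_mult_le:
  assumes "lower_triangular P" "upper_triangular Q"
  shows "rank (upper_left p q (P ** A ** Q)) \<le> rank (upper_left p q A)"
  unfolding upper_left_upper_triangular_mult[OF assms(2)] upper_left_lower_triangular_mult[OF assms(1)]
  by (meson order_trans rank_mul_le_left rank_mul_le_right)

lemma rank_upper_left_mult:
  assumes "lower_unit P" "upper_unit Q"
  shows "rank (upper_left p q (P ** A ** Q)) = rank (upper_left p q A)"
proof (rule antisym)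
  obtain P' Q' where *: "lower_triangular P'" "P' ** P = mat 1" "upper_triangular Q'" "Q ** Q' = mat 1"
    using assms unfolding lower_unit_def upper_unit_def by blast
  then have "A = P' ** (P ** A ** Q) ** Q'"
    by (metis matrix_mul_assoc matrix_mul_lid matrix_mul_rid)
  then show "rank (upper_left p q A) \<le> rank (upper_left p q (P ** A ** Q))"
    using rank_upper_left_mult_le[OF *(1,3), of p q "P ** A ** Q"] by simp
  show "rank (upper_left p q (P ** A ** Q)) \<le> rank (upper_left p q A)"
    using assms rank_upper_left_mult_le unfolding lower_unit_def upper_unit_def by blast
qed

lemma rank_stratum_mult:
  assumes "lower_unit P" "upper_unit Q" "A \<in> rank_stratum \<omega>"
  shows "P ** A ** Q \<in> rank_stratum \<omega>"
  using assms(3) unfolding rank_stratum_def by (simp add: rank_upper_left_mult[OF assms(1,2)])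

lemma rank_stratum_refl: "\<omega> \<in> rank_stratum \<omega>"
  by (simp add: rank_stratum_def)

section \<open>Semicontinuity of the rank\<close>

text \<open>The limit is injective on its row space, with a lower bound \<open>e\<close>; a matrix
  close enough to it remains injective there.\<close>

lemma eventually_rank_ge:
  fixes X :: "'a \<Rightarrow> real^'n^'m"
  assumes "(X \<longlongrightarrow> X\<^sub>0) F"
  shows "eventually (\<lambda>t. rank X\<^sub>0 \<le> rank (X t)) F"
proof -
  let ?W = "span (rows X\<^sub>0)"
  obtain e where e: "0 < e" "\<And>x. x \<in> ?W \<Longrightarrow> e * norm x \<le> norm (X\<^sub>0 *v x)"
    using injective_imp_isometric[of ?W "(*v) X\<^sub>0"] nullspace_inter_rowspace[of X\<^sub>0]
    by (auto simp: closed_subspace matrix_vector_mul_bounded_linear)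
  \<comment> \<open>A crude bound of the operator norm by the entries.\<close>
  define K where "K = real CARD('m) * real CARD('n)"
  have K: "0 < K" by (simp add: K_def)
  have bound: "norm (B *v x) \<le> K * norm B * norm x" for B :: "real^'n^'m" and x
  proof -
    have "\<bar>B $ i $ j\<bar> \<le> norm B" for i j
      using component_le_norm_cart[of "B $ i" j] Finite_Cartesian_Product.norm_nth_le[of B i] by linarith
    then have "onorm ((*v) B) \<le> K * norm B" unfolding K_def by (rule onorm_le_matrix_component)
    then show ?thesis
      using onorm[OF matrix_vector_mul_bounded_linear, of B x] mult_right_mono[OF _ norm_ge_zero]
      by (meson order_trans)
  qed
  have "eventually (\<lambda>t. dist (X t) X\<^sub>0 < e / K) F"
    using assms e(1) K by (intro tendstoD) auto
  then show ?thesis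
  proof eventually_elim
    case (elim t)
    then have small: "K * norm (X t - X\<^sub>0) < e" using K by (simp add: dist_norm field_simps)
    have "x = 0" if x: "x \<in> ?W" "X t *v x = 0" for x
    proof (rule ccontr)
      assume "x \<noteq> 0"
      have "norm (X\<^sub>0 *v x) = norm ((X t - X\<^sub>0) *v x)"
        using x(2) by (simp add: matrix_vector_mult_diff_rdistrib)
      also have "\<dots> \<le> K * norm (X t - X\<^sub>0) * norm x" by (rule bound)
      also have "\<dots> < e * norm x" using small \<open>x \<noteq> 0\<close> by simp
      finally show False using e(2)[OF x(1)] by simp
    qed
    then have "inj_on ((*v) (X t)) ?W"
      by (subst linear_inj_on_iff_eq_0) auto
    then have "dim ((*v) (X t) ` ?W) = dim ?W"
      by (intro dim_image_eq) (auto simp: span_span)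
    then have "rank X\<^sub>0 = dim ((*v) (X t) ` ?W)" by (simp add: row_rank_def)
    also have "\<dots> \<le> rank (X t)" unfolding rank_dim_range by (intro dim_subset) auto
    finally show ?case .
  qed
qed

text \<open>
  Dividing column \<open>l\<close> of \<open>B t\<close> by \<open>t\<close> does not change the rank, but would produce a limit of
  larger rank if the derivative had a nonzero entry in the place \<open>(k, l)\<close>.
\<close>

lemma derivative_entry_zero_if_rank_le:
  fixes B :: "real \<Rightarrow> real^'n^'m"
  assumes deriv: "(B has_vector_derivative B') (at 0)"
    and rank: "eventually (\<lambda>t. rank (B t) \<le> rank (B 0)) (at 0)"
    and row: "\<And>j. B 0 $ k $ j = 0" and col: "\<And>i. B 0 $ i $ l = 0"
  shows "B' $ k $ l = 0"
proof (rule ccontr)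
  assume nz: "B' $ k $ l \<noteq> 0"
  \<comment> \<open>At \<open>t = 0\<close> the entry \<open>1 / t\<close> is 0, which is harmless:
    only \<open>rank (B t ** D t) \<le> rank (B t)\<close> and the punctured limit are used.\<close>
  define D :: "real \<Rightarrow> real^'n^'n" where
    "D t = (\<chi> i j. if i = j then if j = l then 1 / t else 1 else 0)" for t
  define X where "X t = (\<chi> i j. if j = l then B t $ i $ j / t else B t $ i $ j)" for t
  define X0 where "X0 = (\<chi> i j. if j = l then B' $ i $ j else B 0 $ i $ j)"
  have X: "X t = B t ** D t" for t
    by (simp add: X_def D_def vec_eq_iff matrix_mult_nth if_distrib[of "\<lambda>x. _ * x"] cong: if_cong)
  have entry: "((\<lambda>t. B t $ i $ j) has_real_derivative B' $ i $ j) (at 0)" for i j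
    unfolding has_real_derivative_iff_has_vector_derivative
    by (intro bounded_linear.has_vector_derivative[OF bounded_linear_vec_nth] deriv)
  have "(X \<longlongrightarrow> X0) (at 0)"
  proof (intro vec_tendstoI)
    fix i j
    show "((\<lambda>t. X t $ i $ j) \<longlongrightarrow> X0 $ i $ j) (at 0)"
    proof (cases "j = l")
      case True
      then show ?thesis using entry[of i j] col by (simp add: X_def X0_def DERIV_def)
    next
      case False
      then show ?thesis using DERIV_isCont[OF entry[of i j]] by (simp add: X_def X0_def isCont_def)
    qed
  qed
  then have "eventually (\<lambda>t. rank X0 \<le> rank (X t)) (at 0)" by (rule eventually_rank_ge)
  then have "eventually (\<lambda>t. rank X0 \<le> rank (B 0)) (at (0::real))"
    using rank by eventually_elim (metis X order_trans rank_mul_le_left)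
  then have le: "rank X0 \<le> rank (B 0)" by simp
  \<comment> \<open>Column \<open>l\<close> of \<open>B 0\<close> is zero, so clearing coordinate
    \<open>l\<close> of the argument hides the new column of \<open>X0\<close>.\<close>
  have sub: "range ((*v) (B 0)) \<subseteq> range ((*v) X0)"
  proof clarify
    fix x :: "real^'n"
    define y where "y = (\<chi> j. if j = l then 0 else x $ j)"
    have "B 0 *v x = X0 *v y"
      unfolding vec_eq_iff matrix_vector_mult_def X0_def y_def by (auto intro!: sum.cong simp: col)
    then show "B 0 *v x \<in> range ((*v) X0)" by blast
  qed
  \<comment> \<open>Column \<open>l\<close> of \<open>X0\<close> leaves the hyperplane that contains
    the range of \<open>B 0\<close>, which raises the rank by at least one.\<close>
  have "(B 0 *v x) $ k = 0" for x by (simp add: matrix_vector_mult_def row)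
  moreover have "(X0 *v axis l 1) $ k \<noteq> 0"
    using nz by (simp add: matrix_vector_mul_component inner_axis X0_def)
  ultimately have "X0 *v axis l 1 \<notin> range ((*v) (B 0))" by auto
  moreover have "span (range ((*v) (B 0))) = range ((*v) (B 0))"
    by (subst span_eq_iff) (intro linear_subspace_image subspace_UNIV matrix_vector_mul_linear)
  ultimately have "dim (insert (X0 *v axis l 1) (range ((*v) (B 0)))) = rank (B 0) + 1"
    by (simp only: dim_insert rank_dim_range if_False)
  moreover have "dim (insert (X0 *v axis l 1) (range ((*v) (B 0)))) \<le> rank X0"
    unfolding rank_dim_range by (intro dim_subset) (use sub in auto)
  ultimately show False using le by simp
qed

section \<open>Tangent spaces of the rank strata\<close>

text \<open>The velocities at \<open>A\<close> of the group action;
  \<open>tangent_space_rank_stratum\<close> identifies them with the tangent space at the points of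
  the orbit of \<omega>.\<close>

definition orbit_tangent ::
    "real^('n::{finite,linorder})^('m::{finite,linorder})
      \<Rightarrow> (real^('n::{finite,linorder})^('m::{finite,linorder})) set" where
  "orbit_tangent A = {L ** A + A ** R |L R. lower_triangular L \<and> upper_triangular R}"

lemma matrix_add_rdistrib: "(B + C) ** A = B ** A + C ** (A :: 'a::semiring_1^'k^'n)"
  by (simp add: vec_eq_iff matrix_mult_nth sum.distrib distrib_right)

lemma matrix_scaleR_mult:
  fixes A :: "real^'n^'m"
  shows "(c *\<^sub>R A) ** B = c *\<^sub>R (A ** B)" "A ** (c *\<^sub>R B) = c *\<^sub>R (A ** B)"
  by (simp_all add: vec_eq_iff matrix_mult_nth sum_distrib_left mult_ac)

lemma linear_matrix_mult_left: "linear (\<lambda>X. (A :: real^'n^'m) ** (X :: real^'k^'n))"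
  by (intro linearI) (simp_all add: matrix_add_ldistrib matrix_scaleR_mult)

lemma linear_matrix_mult_right: "linear (\<lambda>X. (X :: real^'n^'m) ** (A :: real^'k^'n))"
  by (intro linearI) (simp_all add: matrix_add_rdistrib matrix_scaleR_mult)

lemma subspace_orbit_tangent: "subspace (orbit_tangent A)"
  unfolding subspace_def
proof (intro conjI ballI allI)
  have "0 = 0 ** A + A ** 0" by simp
  then show "0 \<in> orbit_tangent A"
    unfolding orbit_tangent_def using lower_triangular_linear(3) upper_triangular_linear(3) by blast
next
  fix x y assume "x \<in> orbit_tangent A" "y \<in> orbit_tangent A"
  then obtain L R L' R' where x: "x = L ** A + A ** R" and y: "y = L' ** A + A ** R'"
    and tri: "lower_triangular L" "upper_triangular R" "lower_triangular L'" "upper_triangular R'"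
    unfolding orbit_tangent_def by blast
  have "x + y = (L + L') ** A + A ** (R + R')"
    by (simp add: x y matrix_add_ldistrib matrix_add_rdistrib)
  then show "x + y \<in> orbit_tangent A"
    unfolding orbit_tangent_def using tri lower_triangular_linear(1) upper_triangular_linear(1) by blast
next
  fix c x assume "x \<in> orbit_tangent A"
  then obtain L R where x: "x = L ** A + A ** R"
    and tri: "lower_triangular L" "upper_triangular R"
    unfolding orbit_tangent_def by blast
  have "c *\<^sub>R x = (c *\<^sub>R L) ** A + A ** (c *\<^sub>R R)"
    by (simp add: x scaleR_add_right matrix_scaleR_mult)
  then show "c *\<^sub>R x \<in> orbit_tangent A"
    unfolding orbit_tangent_def using tri lower_triangular_linear(2) upper_triangular_linear(2) by blast
qed

lemma orbit_tangent_mult_lower: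
  "lower_triangular L \<Longrightarrow> L ** A \<in> orbit_tangent A"
  unfolding orbit_tangent_def using upper_triangular_linear(3) by force

lemma orbit_tangent_mult_upper:
  "upper_triangular R \<Longrightarrow> A ** R \<in> orbit_tangent A"
  unfolding orbit_tangent_def using lower_triangular_linear(3) by force

text \<open>The pair \<open>L\<close>, \<open>R\<close> at \<open>A\<close> turns into the
  conjugates \<open>P ** L ** P'\<close> and \<open>Q' ** R ** Q\<close>, which are triangular
  again.\<close>

lemma orbit_tangent_translate:
  assumes "lower_unit P" "upper_unit Q" "X \<in> orbit_tangent A"
  shows "P ** X ** Q \<in> orbit_tangent (P ** A ** Q)"
proof -
  obtain P' Q' where P': "lower_triangular P'" "P' ** P = mat 1"
    and Q': "upper_triangular Q'" "Q ** Q' = mat 1"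
    using assms unfolding lower_unit_def upper_unit_def by blast
  obtain L R where X: "X = L ** A + A ** R" and tri: "lower_triangular L" "upper_triangular R"
    using assms unfolding orbit_tangent_def by blast
  have "P ** X ** Q = P ** L ** (P' ** P) ** A ** Q + P ** A ** (Q ** Q') ** R ** Q"
    by (simp add: X P' Q' matrix_add_ldistrib matrix_add_rdistrib matrix_mul_assoc)
  also have "\<dots> = (P ** L ** P') ** (P ** A ** Q) + (P ** A ** Q) ** (Q' ** R ** Q)"
    by (simp only: matrix_mul_assoc)
  finally show ?thesis
    using assms(1,2) P'(1) Q'(1) tri unfolding orbit_tangent_def lower_unit_def upper_unit_def
    by (blast intro: lower_triangular_mult upper_triangular_mult)
qed

lemma orbit_tangent_translate_iff:
  assumes "lower_unit P" "upper_unit Q"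
  shows "P ** X ** Q \<in> orbit_tangent (P ** A ** Q) \<longleftrightarrow> X \<in> orbit_tangent A"
proof
  obtain P' Q' where P': "lower_unit P'" "P' ** P = mat 1"
    and Q': "upper_unit Q'" "Q ** Q' = mat 1"
    using assms unfolding lower_unit_def upper_unit_def by blast
  assume "P ** X ** Q \<in> orbit_tangent (P ** A ** Q)"
  moreover have "P' ** (P ** Y ** Q) ** Q' = Y" for Y
    by (metis P'(2) Q'(2) matrix_mul_assoc matrix_mul_lid matrix_mul_rid)
  ultimately show "X \<in> orbit_tangent A"
    using orbit_tangent_translate[OF P'(1) Q'(1)] by metis
qed (rule orbit_tangent_translate[OF assms])

section \<open>Quadratic curves in the strata\<close>

lemma one_plus_mult:
  fixes A :: "real^'n^'m"
  shows "(mat 1 + t *\<^sub>R L) ** A ** (mat 1 + t *\<^sub>R R)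
    = A + t *\<^sub>R (L ** A + A ** R) + t\<^sup>2 *\<^sub>R (L ** A ** R)"
  by (simp add: matrix_add_ldistrib matrix_add_rdistrib matrix_scaleR_mult
      scaleR_add_right power2_eq_square matrix_mul_assoc)

lemma has_derivative_quadratic:
  fixes A U W :: "'a::real_normed_vector"
  shows "((\<lambda>t. A + t *\<^sub>R U + t\<^sup>2 *\<^sub>R W) has_derivative (\<lambda>h. h *\<^sub>R U + (2 * x * h) *\<^sub>R W)) (at x)"
  by (auto intro!: derivative_eq_intros)

lemma has_vector_derivative_quadratic:
  fixes A U W :: "'a::real_normed_vector"
  shows "((\<lambda>t. A + t *\<^sub>R U + t\<^sup>2 *\<^sub>R W) has_vector_derivative U) (at 0)"
  using has_derivative_quadratic[of A U W 0] by (simp add: has_vector_derivative_def)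

text \<open>Directional derivatives of quadratic curves have the same shape, so the induction runs
  over all coefficients.\<close>

lemma smooth_on_quadratic:
  fixes A U W :: "'a::real_normed_vector"
  shows "smooth_on S (\<lambda>t. A + t *\<^sub>R U + t\<^sup>2 *\<^sub>R W)"
proof -
  have "diff_times_on k S (\<lambda>t. A + t *\<^sub>R U + t\<^sup>2 *\<^sub>R W)" for k and A U W :: 'a
  proof (induction k arbitrary: A U W)
    case 0
    show ?case by (auto intro!: continuous_intros)
  next
    case (Suc k)
    let ?f = "\<lambda>t::real. A + t *\<^sub>R U + t\<^sup>2 *\<^sub>R W"
    have "(\<lambda>x. frechet_derivative (\<lambda>t. A + t *\<^sub>R U + t\<^sup>2 *\<^sub>R W) (at x) v)
        = (\<lambda>x. v *\<^sub>R U + x *\<^sub>R ((2 * v) *\<^sub>R W) + x\<^sup>2 *\<^sub>R 0)" for v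
      unfolding frechet_derivative_at[OF has_derivative_quadratic, symmetric]
      by (simp add: mult_ac)
    then have "diff_times_on k S (\<lambda>x. frechet_derivative ?f (at x) v)" for v
      using Suc.IH[of "v *\<^sub>R U" "(2 * v) *\<^sub>R W" 0] by (simp only:)
    moreover have "?f differentiable (at x)" for x
      using has_derivative_quadratic[of A U W x] unfolding differentiable_def by blast
    ultimately show ?case unfolding diff_times_on.simps by blast
  qed
  then show ?thesis unfolding smooth_on_def by blast
qed

lemma smooth_on_bounded_linear:
  assumes "bounded_linear f"
  shows "smooth_on S f"
  unfolding smooth_on_def
proof
  have const: "diff_times_on k S (\<lambda>_. c)" for k and c :: 'b
    by (induction k arbitrary: c) auto
  have f: "(f has_derivative f) (at x)" for x
    using assms by (rule bounded_linear_imp_has_derivative)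
  then have "f differentiable (at x)" for x by (auto simp: differentiable_def)
  moreover have "frechet_derivative f (at x) = f" for x
    using frechet_derivative_at[OF f] by simp
  ultimately show "diff_times_on k S f" for k
    using assms by (cases k) (simp_all add: const linear_continuous_on)
qed

lemma eventually_mult_units_in:
  assumes "lower_triangular L" "upper_triangular R" "A \<in> rank_stratum \<omega>"
  shows "eventually (\<lambda>t. (mat 1 + t *\<^sub>R L) ** A ** (mat 1 + t *\<^sub>R R) \<in> rank_stratum \<omega>) (nhds 0)"
  using eventually_lower_unit[OF assms(1)] eventually_upper_unit[OF assms(2)]
  by eventually_elim (rule rank_stratum_mult[OF _ _ assms(3)])

text \<open>The witness is the quadratic curve of the two lines through the identity. The inclusion
  holds on the whole stratum, which later makes \<open>L ** y + y ** R\<close> a tangent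
  field.\<close>

lemma orbit_tangent_subset_tangent_space:
  assumes "A \<in> rank_stratum \<omega>"
  shows "orbit_tangent A \<subseteq> tangent_space (rank_stratum \<omega>) A"
proof
  fix v assume "v \<in> orbit_tangent A"
  then obtain L R where v: "v = L ** A + A ** R"
    and tri: "lower_triangular L" "upper_triangular R"
    unfolding orbit_tangent_def by blast
  let ?\<gamma> = "\<lambda>t. (mat 1 + t *\<^sub>R L) ** A ** (mat 1 + t *\<^sub>R R)"
  obtain \<epsilon> where "0 < \<epsilon>" "\<And>t. dist t 0 < \<epsilon> \<Longrightarrow> ?\<gamma> t \<in> rank_stratum \<omega>"
    using eventually_mult_units_in[OF tri assms] unfolding eventually_nhds_metric by blast
  moreover have "smooth_on {-\<epsilon><..<\<epsilon>} ?\<gamma>" "(?\<gamma> has_vector_derivative v) (at 0)"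
    unfolding one_plus_mult v by (rule smooth_on_quadratic has_vector_derivative_quadratic)+
  ultimately show "v \<in> tangent_space (rank_stratum \<omega>) A"
    unfolding tangent_space_def by (auto intro!: exI[of _ ?\<gamma>] exI[of _ \<epsilon>])
qed

definition unit_matrix :: "'m \<Rightarrow> 'n \<Rightarrow> real^'n^'m" where
  "unit_matrix k l = (\<chi> i j. if i = k \<and> j = l then 1 else 0)"

lemma unit_matrix_nth: "unit_matrix k l $ i $ j = (if i = k \<and> j = l then 1 else 0)"
  by (simp add: unit_matrix_def)

lemma unit_matrix_mult_nth: "(unit_matrix k l ** A) $ i $ j = (if i = k then A $ l $ j else 0)"
  by (simp add: unit_matrix_def matrix_mult_nth if_distrib[of "\<lambda>x. x * _"] cong: if_cong)

lemma mult_unit_matrix_nth: "(A ** unit_matrix k l) $ i $ j = (if j = l then A $ i $ k else 0)"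
  by (simp add: unit_matrix_def matrix_mult_nth if_distrib[of "\<lambda>x. _ * x"] cong: if_cong)

lemma lower_triangular_unit_matrix: "l \<le> k \<Longrightarrow> lower_triangular (unit_matrix k l)"
  and upper_triangular_unit_matrix: "k \<le> l \<Longrightarrow> upper_triangular (unit_matrix k l)"
  unfolding lower_triangular_def upper_triangular_def unit_matrix_def by auto

lemma matrix_sum_unit_matrices:
  "(A :: real^'n^'m) = (\<Sum>k\<in>UNIV. \<Sum>l\<in>UNIV. A $ k $ l *\<^sub>R unit_matrix k l)"
proof -
  have "(\<Sum>k\<in>UNIV. \<Sum>l\<in>UNIV. A $ k $ l *\<^sub>R unit_matrix k l) $ i $ j
    = (\<Sum>k\<in>UNIV. if i = k then \<Sum>l\<in>UNIV. if j = l then A $ k $ l else 0 else 0)" for i j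
    unfolding sum_component by (rule sum.cong) (simp_all add: unit_matrix_def if_distrib cong: if_cong)
  then show ?thesis by (simp add: vec_eq_iff)
qed

section \<open>Tangent spaces at \<omega> and along its orbit\<close>

context
  fixes \<omega> :: "real^('n::{finite,linorder})^('m::{finite,linorder})"
  assumes \<omega>: "partial_permutation \<omega>"
begin

text \<open>A one at \<open>(k, j)\<close> with \<open>j \<le> l\<close> is carried to
  \<open>(k, l)\<close> by \<open>unit_matrix j l\<close> on the right, a one at
  \<open>(i, l)\<close> with \<open>i \<le> k\<close> by \<open>unit_matrix k i\<close> on the left.
  The tangent vectors so obtained are unit matrices and span all such \<open>v\<close>.\<close>

lemma orbit_tangent_partial_permutation:
  assumes "\<And>k l. (\<And>j. j \<le> l \<Longrightarrow> \<omega> $ k $ j = 0) \<Longrightarrow> (\<And>i. i \<le> k \<Longrightarrow> \<omega> $ i $ l = 0) \<Longrightarrow> v $ k $ l = 0"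
  shows "v \<in> orbit_tangent \<omega>"
proof -
  have "v $ k $ l *\<^sub>R unit_matrix k l \<in> orbit_tangent \<omega>" for k l
  proof (cases "v $ k $ l = 0")
    case True
    then show ?thesis by (simp add: subspace_0[OF subspace_orbit_tangent])
  next
    case False
    then consider j where "j \<le> l" "\<omega> $ k $ j \<noteq> 0" | i where "i \<le> k" "\<omega> $ i $ l \<noteq> 0"
      using assms by blast
    then have "unit_matrix k l \<in> orbit_tangent \<omega>"
    proof cases
      case 1
      then have one: "\<omega> $ k $ j = 1" using partial_permutation_entry[OF \<omega>] by blast
      have "\<omega> ** unit_matrix j l = unit_matrix k l"
      proof -
        have "\<omega> $ i $ j = (if i = k then 1 else 0)" for i
          using one partial_permutation_entry[OF \<omega>, of i j] partial_permutation_col[OF \<omega>, of k j i]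
          by metis
        then show ?thesis by (simp add: vec_eq_iff mult_unit_matrix_nth unit_matrix_nth)
      qed
      then show ?thesis using orbit_tangent_mult_upper[OF upper_triangular_unit_matrix] 1 by metis
    next
      case 2
      then have one: "\<omega> $ i $ l = 1" using partial_permutation_entry[OF \<omega>] by blast
      have "unit_matrix k i ** \<omega> = unit_matrix k l"
      proof -
        have "\<omega> $ i $ j = (if j = l then 1 else 0)" for j
          using one partial_permutation_entry[OF \<omega>, of i j] partial_permutation_row[OF \<omega>, of i l j]
          by metis
        then show ?thesis by (simp add: vec_eq_iff unit_matrix_mult_nth unit_matrix_nth)
      qed
      then show ?thesis using orbit_tangent_mult_lower[OF lower_triangular_unit_matrix] 2 by metis
    qed
    then show ?thesis by (rule subspace_scale[OF subspace_orbit_tangent])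
  qed
  then show ?thesis
    by (subst matrix_sum_unit_matrices[of v]) (intro subspace_sum subspace_orbit_tangent)
qed

text \<open>In the corner ending at a cell with no one to its left or above, the last row and column
  of \<omega> vanish while the rank is constant along the curve; so the derivative has no entry
  there.\<close>

lemma curve_derivative_in_orbit_tangent:
  assumes \<gamma>: "eventually (\<lambda>t. \<gamma> t \<in> rank_stratum \<omega>) (nhds 0)" "\<gamma> 0 = \<omega>"
    and deriv: "(\<gamma> has_vector_derivative v) (at (0::real))"
  shows "v \<in> orbit_tangent \<omega>"
proof (rule orbit_tangent_partial_permutation)
  fix k l
  assume row: "\<And>j. j \<le> l \<Longrightarrow> \<omega> $ k $ j = 0" and col: "\<And>i. i \<le> k \<Longrightarrow> \<omega> $ i $ l = 0"
  let ?U = "upper_left (pos k) (pos l) :: real^('n::{finite,linorder})^('m::{finite,linorder}) \<Rightarrow> _"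
  have "linear ?U" by (intro linearI) (auto simp: upper_left_def vec_eq_iff)
  then have "((\<lambda>t. ?U (\<gamma> t)) has_vector_derivative ?U v) (at 0)"
    using bounded_linear.has_vector_derivative[OF _ deriv, of ?U]
    by (simp add: linear_conv_bounded_linear)
  moreover have "eventually (\<lambda>t. rank (?U (\<gamma> t)) \<le> rank (?U (\<gamma> 0))) (at 0)"
  proof -
    have "eventually (\<lambda>t. rank (?U (\<gamma> t)) \<le> rank (?U (\<gamma> 0))) (nhds 0)"
      using \<gamma>(1)
    proof eventually_elim
      case (elim t)
      then show ?case using pos_bounds[of k] pos_bounds[of l] \<gamma>(2) by (simp add: rank_stratum_def)
    qed
    then show ?thesis by (auto simp: eventually_at_filter elim: eventually_mono)
  qed
  ultimately have "?U v $ k $ l = 0"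
    by (rule derivative_entry_zero_if_rank_le)
      (auto simp: \<gamma>(2) upper_left_def pos_le_iff row col)
  then show "v $ k $ l = 0" by (simp add: upper_left_def)
qed

text \<open>A curve through another point of the orbit is moved back to \<omega> by the inverses,
  and its derivative is moved forth again.\<close>

lemma tangent_space_rank_stratum:
  assumes "lower_unit P" "upper_unit Q"
  shows "tangent_space (rank_stratum \<omega>) (P ** \<omega> ** Q) = orbit_tangent (P ** \<omega> ** Q)"
proof
  show "orbit_tangent (P ** \<omega> ** Q) \<subseteq> tangent_space (rank_stratum \<omega>) (P ** \<omega> ** Q)"
    by (intro orbit_tangent_subset_tangent_space rank_stratum_mult assms rank_stratum_refl)
next
  obtain P' Q' where P': "lower_unit P'" "P ** P' = mat 1" "P' ** P = mat 1"
    and Q': "upper_unit Q'" "Q ** Q' = mat 1" "Q' ** Q = mat 1"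
    using assms unfolding lower_unit_def upper_unit_def by blast
  show "tangent_space (rank_stratum \<omega>) (P ** \<omega> ** Q) \<subseteq> orbit_tangent (P ** \<omega> ** Q)"
  proof
    fix v assume "v \<in> tangent_space (rank_stratum \<omega>) (P ** \<omega> ** Q)"
    then obtain \<gamma> \<epsilon> where \<gamma>: "0 < \<epsilon>" "\<gamma> ` {-\<epsilon><..<\<epsilon>} \<subseteq> rank_stratum \<omega>" "\<gamma> 0 = P ** \<omega> ** Q"
      "(\<gamma> has_vector_derivative v) (at 0)"
      unfolding tangent_space_def by blast
    have "\<gamma> t \<in> rank_stratum \<omega>" if "dist t 0 < \<epsilon>" for t
      using \<gamma>(2) that by (auto simp: abs_less_iff image_subset_iff)
    then have "eventually (\<lambda>t. P' ** \<gamma> t ** Q' \<in> rank_stratum \<omega>) (nhds 0)"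
      unfolding eventually_nhds_metric
      using \<gamma>(1) rank_stratum_mult[OF P'(1) Q'(1)] by blast
    moreover have "P' ** \<gamma> 0 ** Q' = \<omega>"
      by (metis \<gamma>(3) P'(3) Q'(2) matrix_mul_assoc matrix_mul_lid matrix_mul_rid)
    moreover have "linear (\<lambda>X::real^('n::{finite,linorder})^('m::{finite,linorder}). P' ** X ** Q')"
      using linear_compose[OF linear_matrix_mult_left linear_matrix_mult_right] by (simp add: o_def)
    then have "((\<lambda>t. P' ** \<gamma> t ** Q') has_vector_derivative P' ** v ** Q') (at 0)"
      by (intro bounded_linear.has_vector_derivative[where f="\<lambda>X. P' ** X ** Q'"] \<gamma>(4))
        (simp add: linear_conv_bounded_linear)
    ultimately have "P' ** v ** Q' \<in> orbit_tangent \<omega>"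
      by (rule curve_derivative_in_orbit_tangent)
    then have "P ** (P' ** v ** Q') ** Q \<in> orbit_tangent (P ** \<omega> ** Q)"
      by (rule orbit_tangent_translate[OF assms])
    then show "v \<in> orbit_tangent (P ** \<omega> ** Q)"
      by (metis P'(2) Q'(3) matrix_mul_assoc matrix_mul_lid matrix_mul_rid)
  qed
qed

end

section \<open>Mean curvature along an orbit\<close>

lemma normal_component:
  assumes "subspace T"
  shows "normal_component T w \<in> orthogonal_comp T" "w - normal_component T w \<in> T"
proof -
  have "span T = T" using assms by (simp add: span_eq_iff)
  then obtain y z where y: "y \<in> T" and z: "\<And>x. x \<in> T \<Longrightarrow> orthogonal z x" and w: "w = y + z"
    using orthogonal_subspace_decomp_exists[of T w] by metis
  have "normal_component T w \<in> orthogonal_comp T \<and> w - normal_component T w \<in> T"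
    unfolding normal_component_def
  proof (rule theI)
    show "z \<in> orthogonal_comp T \<and> w - z \<in> T"
      using y z w by (auto simp: orthogonal_comp_def orthogonal_commute)
  next
    fix z' assume z': "z' \<in> orthogonal_comp T \<and> w - z' \<in> T"
    \<comment> \<open>Two candidates differ by a vector of both \<open>T\<close> and its
      complement.\<close>
    have "z' - z = (w - z) - (w - z')" by simp
    also have "\<dots> \<in> T"
      using z' y w assms subspace_diff[of T "w - z" "w - z'"] by simp
    finally have T: "z' - z \<in> T" .
    have "z \<in> orthogonal_comp T"
      using z by (auto simp: orthogonal_comp_def orthogonal_commute)
    then have "z' - z \<in> orthogonal_comp T"
      using z' subspace_diff[OF subspace_orthogonal_comp] by blast
    then show "z' = z" using T by (auto simp: orthogonal_comp_def orthogonal_def)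
  qed
  then show "normal_component T w \<in> orthogonal_comp T" "w - normal_component T w \<in> T" by auto
qed

lemma normal_component_eqI:
  assumes "subspace T" "w - w' \<in> T"
  shows "normal_component T w = normal_component T w'"
proof -
  let ?d = "normal_component T w - normal_component T w'"
  have "?d = (w - w') - (w - normal_component T w) + (w' - normal_component T w')" by simp
  also have "\<dots> \<in> T"
    by (intro subspace_add subspace_diff assms normal_component(2))
  finally have "?d \<in> T" .
  moreover have "?d \<in> orthogonal_comp T"
    by (intro subspace_diff subspace_orthogonal_comp normal_component(1) assms(1))
  ultimately show ?thesis by (auto simp: orthogonal_comp_def orthogonal_def)
qed

lemma inner_normal_component:
  assumes "subspace T" "N \<in> orthogonal_comp T"
  shows "N \<bullet> normal_component T w = N \<bullet> w"
  using normal_component(2)[OF assms(1), of w] assms(2)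
  by (auto simp: orthogonal_comp_def orthogonal_def inner_diff_right inner_commute)

text \<open>The trace over \<open>T\<close> of a product of two linear forms; it sees only the
  orthogonal projection \<open>X\<^sub>1\<close> of \<open>X\<close> to \<open>T\<close>.\<close>

lemma sum_inner_orthonormal_basis:
  assumes B: "orthonormal_basis_of T B" and X: "X\<^sub>1 \<in> T" "X - X\<^sub>1 \<in> orthogonal_comp T"
  shows "(\<Sum>e\<in>B. (e \<bullet> X) * (e \<bullet> Y)) = X\<^sub>1 \<bullet> Y"
proof -
  have "finite B" "span B = T" and B': "pairwise orthogonal B" "\<And>b. b \<in> B \<Longrightarrow> norm b = 1"
    using B pairwise_orthogonal_imp_finite unfolding orthonormal_basis_of_def by auto
  then have "X\<^sub>1 = (\<Sum>e\<in>B. (X\<^sub>1 \<bullet> e) *\<^sub>R e)"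
    using orthonormal_basis_expand[OF B'] X(1) by simp
  moreover have "X\<^sub>1 \<bullet> e = e \<bullet> X" if "e \<in> B" for e
  proof -
    have "e \<in> T" using that \<open>span B = T\<close> span_base by blast
    then show ?thesis
      using X(2) by (auto simp: orthogonal_comp_def orthogonal_def inner_diff_right inner_commute)
  qed
  ultimately have "X\<^sub>1 = (\<Sum>e\<in>B. (e \<bullet> X) *\<^sub>R e)" by simp
  then show ?thesis by (simp add: inner_sum_left)
qed

text \<open>This removes the choice operator: later computations treat the basis as
  arbitrary.\<close>

lemma mean_curvature_vector_basis:
  assumes "subspace (tangent_space M x)"
  obtains B where "orthonormal_basis_of (tangent_space M x) B"
    "mean_curvature_vector M x = (\<Sum>e\<in>B. second_fundamental_form M x e e)"
proof -
  obtain B where "orthonormal_basis_of (tangent_space M x) B"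
    using orthonormal_basis_subspace[OF assms] unfolding orthonormal_basis_of_def by metis
  then show ?thesis
    using that[of "SOME B. orthonormal_basis_of (tangent_space M x) B"] someI
    unfolding mean_curvature_vector_def by metis
qed

text \<open>
  A near-identity translation moves the tangent space at \<open>A\<close> to the one at \<open>P\<^sub>t A Q\<^sub>t\<close>; so a
  family of vectors in the latter spaces that vanishes at \<open>t = 0\<close> is tangent at \<open>A\<close> to first order.
\<close>

lemma derivative_of_translated_in_subspace:
  fixes g :: "real \<Rightarrow> real^'n^'m"
  assumes T: "subspace T"
    and g: "eventually (\<lambda>t. \<exists>y\<in>T. g t = (mat 1 + t *\<^sub>R L) ** y ** (mat 1 + t *\<^sub>R R)) (nhds 0)"
    and g0: "g 0 = 0" and deriv: "(g has_vector_derivative w) (at 0)"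
  shows "w \<in> T"
proof -
  have "bounded_linear (\<lambda>y::real^'n^'m. L ** y + y ** R)"
    by (simp add: linear_conv_bounded_linear[symmetric] linear_compose_add
        linear_matrix_mult_left linear_matrix_mult_right)
  then obtain K1 where K1: "\<And>y. norm (L ** y + y ** R :: real^'n^'m) \<le> norm y * K1" "0 < K1"
    using bounded_linear.pos_bounded by blast
  have "bounded_linear (\<lambda>y::real^'n^'m. L ** y ** R)"
    using linear_compose[OF linear_matrix_mult_left[of L] linear_matrix_mult_right[of R]]
    by (simp add: linear_conv_bounded_linear o_def)
  then obtain K2 where K2: "\<And>y. norm (L ** y ** R :: real^'n^'m) \<le> norm y * K2" "0 < K2"
    using bounded_linear.pos_bounded by blast
  define K where "K = K1 + K2"
  have K: "0 < K" using K1(2) K2(2) by (simp add: K_def)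
  have close: "norm ((mat 1 + t *\<^sub>R L) ** y ** (mat 1 + t *\<^sub>R R) - y) \<le> \<bar>t\<bar> * K * norm y"
    if "\<bar>t\<bar> < 1" for t and y :: "real^'n^'m"
  proof -
    have "norm ((mat 1 + t *\<^sub>R L) ** y ** (mat 1 + t *\<^sub>R R) - y)
        = norm (t *\<^sub>R (L ** y + y ** R) + t\<^sup>2 *\<^sub>R (L ** y ** R))"
      by (simp add: one_plus_mult)
    also have "\<dots> \<le> \<bar>t\<bar> * (norm y * K1) + t\<^sup>2 * (norm y * K2)"
      using K1(1)[of y] K2(1)[of y]
      by (intro norm_triangle_le add_mono) (auto intro!: mult_left_mono)
    also have "t\<^sup>2 * (norm y * K2) \<le> \<bar>t\<bar> * (norm y * K2)"
    proof -
      have "t\<^sup>2 \<le> \<bar>t\<bar>"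
        using that mult_right_mono[of "\<bar>t\<bar>" 1 "\<bar>t\<bar>"] by (simp add: power2_eq_square)
      then show ?thesis using K2(2) by (intro mult_right_mono) auto
    qed
    finally show ?thesis by (simp add: K_def algebra_simps)
  qed
  \<comment> \<open>\<open>T\<close> is its own double orthogonal complement, so testing against
    normals suffices.\<close>
  have "N \<bullet> w = 0" if N: "N \<in> orthogonal_comp T" for N
  proof -
    have "((\<lambda>t. N \<bullet> g t) has_real_derivative N \<bullet> w) (at 0)"
      unfolding has_real_derivative_iff_has_vector_derivative
      by (rule bounded_linear.has_vector_derivative[OF bounded_linear_inner_right deriv])
    then have lim: "((\<lambda>t. (N \<bullet> g t) / t) \<longlongrightarrow> N \<bullet> w) (at 0)"
      by (simp add: DERIV_def g0)
    have "(g \<longlongrightarrow> 0) (at 0)"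
      using has_vector_derivative_continuous[OF deriv] g0 by (simp add: continuous_within)
    then have bound_lim: "((\<lambda>t. norm N * (2 * K) * norm (g t)) \<longlongrightarrow> 0) (at 0)"
      using tendsto_mult_right_zero tendsto_norm_zero by blast
    \<comment> \<open>With \<open>\<bar>t\<bar> * K \<le> 1 / 2\<close> the vector \<open>y\<close>
      is at most twice as long as \<open>g t\<close>.\<close>
    have small: "eventually (\<lambda>t. \<bar>t\<bar> < min 1 (1 / (2 * K))) (nhds 0)"
      using K by (auto simp: eventually_nhds_metric intro!: exI[of _ "min 1 (1 / (2 * K))"])
    have "eventually (\<lambda>t. norm ((N \<bullet> g t) / t) \<le> norm N * (2 * K) * norm (g t)) (nhds 0)"
      using g small
    proof eventually_elim
      case (elim t)
      then obtain y where y: "y \<in> T" "g t = (mat 1 + t *\<^sub>R L) ** y ** (mat 1 + t *\<^sub>R R)" by blast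
      have t: "\<bar>t\<bar> < 1" "\<bar>t\<bar> * K \<le> 1 / 2" using elim K by (auto simp: field_simps)
      have d: "norm (g t - y) \<le> \<bar>t\<bar> * K * norm y" unfolding y by (rule close[OF t(1)])
      also have "\<dots> \<le> 1 / 2 * norm y" using t(2) by (intro mult_right_mono) auto
      finally have "norm y \<le> 2 * norm (g t)" using norm_triangle_ineq2[of y "g t"]
        by (simp add: norm_minus_commute)
      then have d': "norm (g t - y) \<le> \<bar>t\<bar> * (2 * K * norm (g t))"
        using order_trans[OF d mult_left_mono[of "norm y" "2 * norm (g t)" "\<bar>t\<bar> * K"]] K
        by (simp add: mult_ac)
      \<comment> \<open>\<open>N\<close> annihilates \<open>y\<close>, so the difference quotient is
        bounded by a multiple of \<open>norm (g t)\<close>, which tends to 0.\<close>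
      have "N \<bullet> g t = N \<bullet> (g t - y)"
        using N y(1) by (auto simp: orthogonal_comp_def orthogonal_def inner_diff_right inner_commute)
      then have "\<bar>N \<bullet> g t\<bar> \<le> norm N * norm (g t - y)" using Cauchy_Schwarz_ineq2 by metis
      also have "\<dots> \<le> norm N * (\<bar>t\<bar> * (2 * K * norm (g t)))"
        by (intro mult_left_mono d') auto
      finally have "\<bar>N \<bullet> g t\<bar> \<le> norm N * (\<bar>t\<bar> * (2 * K * norm (g t)))" .
      then show ?case using K by (cases "t = 0") (simp_all add: abs_divide field_simps)
    qed
    then have "eventually (\<lambda>t. norm ((N \<bullet> g t) / t) \<le> norm N * (2 * K) * norm (g t)) (at 0)"
      by (auto simp: eventually_at_filter elim: eventually_mono)
    then have "((\<lambda>t. (N \<bullet> g t) / t) \<longlongrightarrow> 0) (at 0)"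
      using bound_lim by (rule Lim_null_comparison)
    then show ?thesis using lim LIM_unique by blast
  qed
  then have "w \<in> orthogonal_comp (orthogonal_comp T)"
    by (auto simp: orthogonal_comp_def[of "orthogonal_comp T"] orthogonal_def)
  then show ?thesis by (simp add: orthogonal_comp_self[OF T])
qed

section \<open>The second fundamental form along the orbit\<close>

context
  fixes \<omega> P Q A
  assumes \<omega>: "partial_permutation \<omega>"
    and P: "lower_unit P" and Q: "upper_unit Q" and A: "A = P ** \<omega> ** Q"
begin

text \<open>Along the curve, \<open>V\<close> is compared with the translate of \<open>V A\<close>.
  Both are tangent and they agree at \<open>t = 0\<close>, so the derivatives differ by a tangent
  vector. Hence the normal part depends on \<open>V A\<close> only.\<close>

lemma local_tangent_field_derivative:
  assumes V: "local_tangent_field (rank_stratum \<omega>) A V"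
    and tri: "lower_triangular L" "upper_triangular R"
  shows "frechet_derivative V (at A) (L ** A + A ** R) - (L ** V A + V A ** R) \<in> orbit_tangent A"
proof -
  let ?P = "\<lambda>t. mat 1 + t *\<^sub>R L" and ?Q = "\<lambda>t. mat 1 + t *\<^sub>R R" and ?D = "frechet_derivative V (at A)"
  let ?\<gamma> = "\<lambda>t. ?P t ** A ** ?Q t"
  obtain U where U: "open U" "A \<in> U" "smooth_on U V"
    "\<And>y. y \<in> rank_stratum \<omega> \<Longrightarrow> y \<in> U \<Longrightarrow> V y \<in> tangent_space (rank_stratum \<omega>) y"
    using V unfolding local_tangent_field_def by blast
  have mem: "A \<in> rank_stratum \<omega>" unfolding A by (intro rank_stratum_mult P Q rank_stratum_refl)
  have "diff_times_on (Suc 0) U V" using U(3) unfolding smooth_on_def by blast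
  then have "(V has_derivative ?D) (at A)" using U(2) frechet_derivative_works by auto
  moreover have \<gamma>: "(?\<gamma> has_vector_derivative (L ** A + A ** R)) (at 0)"
    unfolding one_plus_mult by (rule has_vector_derivative_quadratic)
  ultimately have "(V \<circ> ?\<gamma> has_derivative ?D \<circ> (\<lambda>h. h *\<^sub>R (L ** A + A ** R))) (at 0)"
    unfolding has_vector_derivative_def by (intro diff_chain_at) simp_all
  moreover have "linear ?D"
    using \<open>(V has_derivative ?D) (at A)\<close> by (rule has_derivative_linear)
  ultimately have "(V \<circ> ?\<gamma> has_vector_derivative ?D (L ** A + A ** R)) (at 0)"
    by (simp add: has_vector_derivative_def o_def linear_scale)
  moreover have "((\<lambda>t. ?P t ** V A ** ?Q t) has_vector_derivative (L ** V A + V A ** R)) (at 0)"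
    unfolding one_plus_mult by (rule has_vector_derivative_quadratic)
  ultimately have deriv: "((\<lambda>t. (V \<circ> ?\<gamma>) t - ?P t ** V A ** ?Q t) has_vector_derivative
      ?D (L ** A + A ** R) - (L ** V A + V A ** R)) (at 0)"
    by (rule has_vector_derivative_diff)
  have VA: "V A \<in> orbit_tangent A"
    using U(4)[OF mem U(2)] tangent_space_rank_stratum[OF \<omega> P Q] by (simp add: A)
  define \<gamma> where "\<gamma> = ?\<gamma>"
  have "(\<gamma> \<longlongrightarrow> \<gamma> 0) (nhds 0)"
    using has_vector_derivative_continuous[OF \<gamma>]
    by (simp only: isCont_def tendsto_at_iff_tendsto_nhds flip: \<gamma>_def)
  then have "(?\<gamma> \<longlongrightarrow> A) (nhds 0)" by (simp add: \<gamma>_def)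
  then have ev: "eventually (\<lambda>t. ?\<gamma> t \<in> U) (nhds 0)" using U(1,2) by (rule topological_tendstoD)
  have "eventually (\<lambda>t. \<exists>y\<in>orbit_tangent A. (V \<circ> ?\<gamma>) t - ?P t ** V A ** ?Q t = ?P t ** y ** ?Q t) (nhds 0)"
    using ev eventually_lower_unit[OF tri(1)] eventually_upper_unit[OF tri(2)]
  proof eventually_elim
    case (elim t)
    have "?\<gamma> t \<in> rank_stratum \<omega>" using elim by (intro rank_stratum_mult mem)
    then have "V (?\<gamma> t) \<in> tangent_space (rank_stratum \<omega>) (?\<gamma> t)" using U(4) elim by blast
    moreover have "?\<gamma> t = (?P t ** P) ** \<omega> ** (Q ** ?Q t)" by (simp only: A matrix_mul_assoc)
    ultimately have 1: "V (?\<gamma> t) \<in> orbit_tangent (?\<gamma> t)"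
      using tangent_space_rank_stratum[OF \<omega> lower_unit_mult[OF elim(2) P] upper_unit_mult[OF Q elim(3)]]
      by metis
    obtain P' Q' where "?P t ** P' = mat 1" "Q' ** ?Q t = mat 1"
      using elim unfolding lower_unit_def upper_unit_def by blast
    then have "V (?\<gamma> t) = ?P t ** (P' ** V (?\<gamma> t) ** Q') ** ?Q t"
      by (metis matrix_mul_assoc matrix_mul_lid matrix_mul_rid)
    then obtain z where z: "V (?\<gamma> t) = ?P t ** z ** ?Q t" by blast
    then have "z \<in> orbit_tangent A" using 1 orbit_tangent_translate_iff[OF elim(2,3)] by simp
    then have "z - V A \<in> orbit_tangent A" using VA by (intro subspace_diff subspace_orbit_tangent)
    moreover have "(V \<circ> ?\<gamma>) t - ?P t ** V A ** ?Q t = ?P t ** (z - V A) ** ?Q t"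
      by (simp only: z o_apply linear_diff[OF linear_matrix_mult_left]
          linear_diff[OF linear_matrix_mult_right])
    ultimately show ?case by blast
  qed
  then show ?thesis
    by (rule derivative_of_translated_in_subspace[OF subspace_orbit_tangent _ _ deriv]) simp
qed

lemma inner_second_fundamental_form:
  assumes N: "N \<in> orthogonal_comp (orbit_tangent A)"
    and tri: "lower_triangular L" "upper_triangular R" and e: "e = L ** A + A ** R"
  shows "N \<bullet> second_fundamental_form (rank_stratum \<omega>) A e e = 2 * (N \<bullet> (L ** A ** R))"
proof -
  let ?M = "rank_stratum \<omega>"
  have T: "tangent_space ?M A = orbit_tangent A"
    unfolding A by (rule tangent_space_rank_stratum[OF \<omega> P Q])
  have sub: "subspace (orbit_tangent A)" by (rule subspace_orbit_tangent)
  let ?V = "\<lambda>y. L ** y + y ** R"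
  have lin: "bounded_linear ?V"
    by (simp add: linear_conv_bounded_linear[symmetric] linear_compose_add
        linear_matrix_mult_left linear_matrix_mult_right)
  have field: "local_tangent_field ?M A ?V"
    unfolding local_tangent_field_def
  proof (intro exI[of _ UNIV] conjI ballI)
    fix y assume "y \<in> rank_stratum \<omega> \<inter> UNIV"
    moreover have "?V y \<in> orbit_tangent y" using tri unfolding orbit_tangent_def by blast
    ultimately show "?V y \<in> tangent_space ?M y" using orbit_tangent_subset_tangent_space by blast
  qed (simp_all add: smooth_on_bounded_linear[OF lin])
  have "second_fundamental_form ?M A e e = normal_component (orbit_tangent A) (L ** e + e ** R)"
    unfolding second_fundamental_form_def T
  proof (rule the_equality)
    have "frechet_derivative ?V (at A) e = L ** e + e ** R"
      using frechet_derivative_at[OF bounded_linear_imp_has_derivative[OF lin]] by metis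
    then show "\<exists>V. local_tangent_field ?M A V \<and> V A = e \<and>
      normal_component (orbit_tangent A) (L ** e + e ** R) =
      normal_component (orbit_tangent A) (frechet_derivative V (at A) e)"
      using field e by (intro exI[of _ ?V]) simp
  next
    fix w assume "\<exists>V. local_tangent_field ?M A V \<and> V A = e \<and>
      w = normal_component (orbit_tangent A) (frechet_derivative V (at A) e)"
    then obtain V where V: "local_tangent_field ?M A V" "V A = e"
      and w: "w = normal_component (orbit_tangent A) (frechet_derivative V (at A) e)" by blast
    have "frechet_derivative V (at A) e - (L ** e + e ** R) \<in> orbit_tangent A"
      using local_tangent_field_derivative[OF V(1) tri] V(2) e by simp
    then show "w = normal_component (orbit_tangent A) (L ** e + e ** R)"
      unfolding w by (rule normal_component_eqI[OF sub])
  qed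
  then have "N \<bullet> second_fundamental_form ?M A e e = N \<bullet> (L ** e + e ** R)"
    using inner_normal_component[OF sub N] by simp
  \<comment> \<open>\<open>L ** L\<close> and \<open>R ** R\<close> are triangular, so the first
    summand is tangent and only the mixed term survives.\<close>
  also have "L ** e + e ** R = ((L ** L) ** A + A ** (R ** R)) + 2 *\<^sub>R (L ** A ** R)"
    by (simp add: e matrix_add_ldistrib matrix_add_rdistrib matrix_mul_assoc scaleR_2)
  also have "N \<bullet> \<dots> = N \<bullet> ((L ** L) ** A + A ** (R ** R)) + 2 * (N \<bullet> (L ** A ** R))"
    by (simp add: inner_add_right)
  also have "(L ** L) ** A + A ** (R ** R) \<in> orbit_tangent A"
    unfolding orbit_tangent_def using tri by (blast intro: lower_triangular_mult upper_triangular_mult)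
  then have "N \<bullet> ((L ** L) ** A + A ** (R ** R)) = 0"
    using N by (auto simp: orthogonal_comp_def orthogonal_def inner_commute)
  finally show ?thesis by simp
qed

end

section \<open>A point of nonzero mean curvature\<close>

definition outer :: "real^'m \<Rightarrow> real^'n \<Rightarrow> real^'n^'m" where
  "outer u v = (\<chi> i j. u $ i * v $ j)"

lemma inner_outer: "X \<bullet> outer u v = u \<bullet> (X *v v)"
  by (simp add: inner_vec_def outer_def matrix_vector_mult_def sum_distrib_left mult_ac)

lemma matrix_axis_nth: "((A :: real^'n^'m) *v axis j 1) $ i = A $ i $ j"
  by (simp add: matrix_vector_mul_component inner_axis)

definition restrict_rows :: "'m set \<Rightarrow> real^'n^'m \<Rightarrow> real^'n^'m" where
  "restrict_rows I X = (\<chi> i j. if i \<in> I then X $ i $ j else 0)"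

lemma inner_restrict_rows: "restrict_rows I X \<bullet> Y = X \<bullet> restrict_rows I Y"
  by (auto simp: inner_vec_def restrict_rows_def intro!: sum.cong)

lemma restrict_rows_mult: "restrict_rows I (A ** B) = restrict_rows I A ** B"
  by (auto simp: vec_eq_iff restrict_rows_def matrix_mult_nth)

lemma restrict_rows_linear:
  "restrict_rows I (X + Y) = restrict_rows I X + restrict_rows I Y"
  "restrict_rows I (X - Y) = restrict_rows I X - restrict_rows I Y"
  by (auto simp: vec_eq_iff restrict_rows_def)

section \<open>The base point and its normal vectors\<close>

locale nonvexillary_pattern =
  fixes \<omega> :: "real^('n::{finite,linorder})^('m::{finite,linorder})"
    and i\<^sub>1 i\<^sub>2 p :: "'m::{finite,linorder}" and a b q :: "'n::{finite,linorder}"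
  assumes \<omega>: "partial_permutation \<omega>"
    and order: "i\<^sub>1 < i\<^sub>2" "i\<^sub>2 < p" "a < b" "b < q"
    and ones: "\<omega> $ i\<^sub>1 $ b = 1" "\<omega> $ i\<^sub>2 $ a = 1"
    and row: "\<And>j. j \<le> q \<Longrightarrow> \<omega> $ p $ j = 0"
    and col: "\<And>i. i \<le> p \<Longrightarrow> \<omega> $ i $ q = 0"
begin

definition P :: "real^('m::{finite,linorder})^('m::{finite,linorder})" where "P = mat 1 + unit_matrix p i\<^sub>1"
definition P' :: "real^('m::{finite,linorder})^('m::{finite,linorder})" where "P' = mat 1 - unit_matrix p i\<^sub>1"
definition Q :: "real^('n::{finite,linorder})^('n::{finite,linorder})" where "Q = mat 1 + unit_matrix b q + unit_matrix a q"
definition Q' :: "real^('n::{finite,linorder})^('n::{finite,linorder})" where "Q' = mat 1 - unit_matrix b q - unit_matrix a q"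
definition A :: "real^('n::{finite,linorder})^('m::{finite,linorder})" where "A = P ** \<omega> ** Q"
text \<open>\<open>n\<close> is row \<open>p\<close> of \<open>P'\<close> and \<mu> is column
  \<open>q\<close> of \<open>Q'\<close>, so pairing \<open>P ** Y ** Q\<close> with
  \<open>outer n \<mu>\<close> reads off \<open>Y $ p $ q\<close>.\<close>

definition n :: "real^('m::{finite,linorder})" where "n = axis p 1 - axis i\<^sub>1 1"
definition \<mu> :: "real^('n::{finite,linorder})" where "\<mu> = axis q 1 - axis b 1 - axis a 1"

lemma distinct: "i\<^sub>1 \<noteq> i\<^sub>2" "i\<^sub>1 \<noteq> p" "i\<^sub>2 \<noteq> p" "a \<noteq> b" "a \<noteq> q" "b \<noteq> q"
  using order by auto

lemma P_mult_nth: "(P ** X) $ i $ j = X $ i $ j + (if i = p then X $ i\<^sub>1 $ j else 0)"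
  by (simp add: P_def matrix_add_rdistrib unit_matrix_mult_nth)

lemma mult_Q_nth: "(X ** Q) $ i $ j = X $ i $ j + (if j = q then X $ i $ b + X $ i $ a else 0)"
  by (simp add: Q_def matrix_add_ldistrib mult_unit_matrix_nth)

lemma triangular: "lower_triangular P" "lower_triangular P'" "upper_triangular Q" "upper_triangular Q'"
  using order
  by (auto simp: P_def P'_def Q_def Q'_def lower_triangular_def upper_triangular_def mat_def unit_matrix_nth)

lemma P_inverse: "P ** P' = mat 1" "P' ** P = mat 1"
proof -
  show "P ** P' = mat 1"
    using distinct by (simp add: vec_eq_iff P_mult_nth) (simp add: P'_def mat_def unit_matrix_nth)
  then show "P' ** P = mat 1" using matrix_left_right_inverse by blast
qed

lemma Q_inverse: "Q ** Q' = mat 1" "Q' ** Q = mat 1"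
proof -
  show "Q' ** Q = mat 1"
    using distinct by (simp add: vec_eq_iff mult_Q_nth) (simp add: Q'_def mat_def unit_matrix_nth)
  then show "Q ** Q' = mat 1" using matrix_left_right_inverse by blast
qed

lemma unit_P: "lower_unit P" and unit_Q: "upper_unit Q"
  unfolding lower_unit_def upper_unit_def using triangular P_inverse Q_inverse by blast+

lemma A_in_stratum: "A \<in> rank_stratum \<omega>"
  unfolding A_def by (intro rank_stratum_mult unit_P unit_Q rank_stratum_refl)

lemma tangent_space_A: "tangent_space (rank_stratum \<omega>) A = orbit_tangent A"
  unfolding A_def by (rule tangent_space_rank_stratum[OF \<omega> unit_P unit_Q])

lemma orbit_tangent_AE:
  assumes "e \<in> orbit_tangent A"
  obtains L R where "lower_triangular L" "upper_triangular R" "e = P ** (L ** \<omega> + \<omega> ** R) ** Q"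
proof -
  have e: "e = P ** (P' ** e ** Q') ** Q"
    by (metis P_inverse(1) Q_inverse(2) matrix_mul_assoc matrix_mul_lid matrix_mul_rid)
  then have "P' ** e ** Q' \<in> orbit_tangent \<omega>"
    using assms orbit_tangent_translate_iff[OF unit_P unit_Q] unfolding A_def by metis
  then show ?thesis using that e unfolding orbit_tangent_def by fastforce
qed

lemma inner_n: "n \<bullet> x = x $ p - x $ i\<^sub>1"
  by (simp add: n_def inner_diff_left inner_axis')

lemma mult_\<mu>: "(X *v \<mu>) $ i = X $ i $ q - X $ i $ b - X $ i $ a"
  by (simp add: \<mu>_def matrix_vector_mult_diff_distrib matrix_axis_nth)

text \<open>Here \<open>n\<close> undoes the row operation, and the column operation changes only
  column \<open>q\<close>.\<close>

lemma inner_n_axis: "j \<noteq> q \<Longrightarrow> (P ** Y ** Q) \<bullet> outer n (axis j 1) = Y $ p $ j"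
  using distinct by (simp add: inner_outer inner_n matrix_axis_nth mult_Q_nth P_mult_nth)

lemma inner_axis_\<mu>: "k \<noteq> p \<Longrightarrow> (P ** Y ** Q) \<bullet> outer (axis k 1) \<mu> = Y $ k $ q"
  using distinct by (simp add: inner_outer inner_axis' mult_\<mu> mult_Q_nth P_mult_nth)

lemma inner_n_\<mu>: "(P ** Y ** Q) \<bullet> outer n \<mu> = Y $ p $ q"
  using distinct by (simp add: inner_outer inner_n mult_\<mu> mult_Q_nth P_mult_nth)

text \<open>Multiplication by \<open>L\<close> moves ones only downwards; dually, \<open>R\<close>
  moves them only to the right.\<close>

lemma mult_\<omega>_nth_zero:
  assumes "lower_triangular L" "\<And>i. i \<le> k \<Longrightarrow> \<omega> $ i $ l = 0"
  shows "(L ** \<omega>) $ k $ l = 0"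
  unfolding matrix_mult_nth
proof (rule sum.neutral, rule ballI)
  show "L $ k $ i * \<omega> $ i $ l = 0" for i
    using assms by (cases "i \<le> k") (auto simp: lower_triangular_def)
qed

lemma \<omega>_mult_nth_zero:
  assumes "upper_triangular R" "\<And>j. j \<le> l \<Longrightarrow> \<omega> $ k $ j = 0"
  shows "(\<omega> ** R) $ k $ l = 0"
  unfolding matrix_mult_nth
proof (rule sum.neutral, rule ballI)
  show "\<omega> $ k $ j * R $ j $ l = 0" for j
    using assms by (cases "j \<le> l") (auto simp: upper_triangular_def)
qed

lemma \<omega>_column: "\<omega> $ k $ j = 1 \<Longrightarrow> \<omega> $ i $ j = (if i = k then 1 else 0)"
  using partial_permutation_entry[OF \<omega>, of i j] partial_permutation_col[OF \<omega>, of k j i] by metis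

lemma \<omega>_row: "\<omega> $ k $ j = 1 \<Longrightarrow> \<omega> $ k $ l = (if l = j then 1 else 0)"
  using partial_permutation_entry[OF \<omega>, of k l] partial_permutation_row[OF \<omega>, of k j l] by metis

lemma mult_\<omega>_nth_one: "\<omega> $ k $ j = 1 \<Longrightarrow> (L ** \<omega>) $ i $ j = L $ i $ k"
  by (simp add: matrix_mult_nth \<omega>_column if_distrib[of "\<lambda>x. _ * x"] cong: if_cong)

lemma \<omega>_mult_nth_one: "\<omega> $ k $ j = 1 \<Longrightarrow> (\<omega> ** R) $ k $ l = R $ j $ l"
  by (simp add: matrix_mult_nth \<omega>_row if_distrib[of "\<lambda>x. x * _"] cong: if_cong)

lemma normal_n_\<mu>: "outer n \<mu> \<in> orthogonal_comp (orbit_tangent A)"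
  unfolding orthogonal_comp_def orthogonal_def
proof clarify
  fix e assume "e \<in> orbit_tangent A"
  then obtain L R where "lower_triangular L" "upper_triangular R" "e = P ** (L ** \<omega> + \<omega> ** R) ** Q"
    by (rule orbit_tangent_AE)
  then show "e \<bullet> outer n \<mu> = 0"
    by (simp add: inner_n_\<mu> mult_\<omega>_nth_zero \<omega>_mult_nth_zero row col)
qed

lemma inner_unit_matrix: "X \<bullet> unit_matrix k l = X $ k $ l"
proof -
  have "unit_matrix k l = outer (axis k 1) (axis l 1)"
    by (auto simp: vec_eq_iff unit_matrix_nth outer_def axis_def)
  then show ?thesis by (simp add: inner_outer inner_axis' matrix_axis_nth)
qed

text \<open>The cell lies left of the one in its row and above the one in its column, and
  \<open>P\<close>, \<open>Q\<close> alter only row \<open>p\<close> and column \<open>q\<close>. As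
  \<open>outer n \<mu>\<close> has entry 1 there, this normal enters the projection in
  \<open>cell_trace\<close>.\<close>

lemma normal_unit_matrix: "unit_matrix i\<^sub>1 a \<in> orthogonal_comp (orbit_tangent A)"
  unfolding orthogonal_comp_def orthogonal_def
proof clarify
  fix e assume "e \<in> orbit_tangent A"
  then obtain L R where tri: "lower_triangular L" "upper_triangular R"
    and e: "e = P ** (L ** \<omega> + \<omega> ** R) ** Q"
    by (rule orbit_tangent_AE)
  have "(L ** \<omega>) $ i\<^sub>1 $ a = 0"
    by (rule mult_\<omega>_nth_zero[OF tri(1)]) (use \<omega>_column[OF ones(2)] order in auto)
  moreover have "(\<omega> ** R) $ i\<^sub>1 $ a = 0"
    by (rule \<omega>_mult_nth_zero[OF tri(2)]) (use \<omega>_row[OF ones(1)] order in auto)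
  ultimately show "e \<bullet> unit_matrix i\<^sub>1 a = 0"
    using distinct by (simp add: e inner_unit_matrix mult_Q_nth P_mult_nth)
qed

definition cells :: "('m \<times> 'n) set" where
  "cells = {(k, j). k \<le> p \<and> j \<le> q \<and> \<omega> $ k $ j = 1}"

lemma cells_less: "(k, j) \<in> cells \<Longrightarrow> k \<noteq> p \<and> j \<noteq> q"
  using row[of j] col[of k] by (auto simp: cells_def)

text \<open>
  By the preceding formula the left-hand side is \<open>2 (L \<omega> R)\<^sub>p\<^sub>q\<close> for \<open>e = P (L \<omega> + \<omega> R) Q\<close>. Only
  the ones of \<open>\<omega>\<close> north-west of \<open>(p, q)\<close> contribute to it, and for such a one in place \<open>(k, j)\<close> the
  entries \<open>L\<^sub>p\<^sub>k\<close> and \<open>R\<^sub>j\<^sub>q\<close> are linear functions of \<open>e\<close>.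
\<close>

lemma inner_second_fundamental_form_cells:
  assumes "e \<in> orbit_tangent A"
  shows "outer n \<mu> \<bullet> second_fundamental_form (rank_stratum \<omega>) A e e =
    2 * (\<Sum>(k, j)\<in>cells. (e \<bullet> outer n (axis j 1)) * (e \<bullet> outer (axis k 1) \<mu>))"
proof -
  obtain L R where tri: "lower_triangular L" "upper_triangular R"
    and e: "e = P ** (L ** \<omega> + \<omega> ** R) ** Q"
    using assms by (rule orbit_tangent_AE)
  \<comment> \<open>Conjugation turns the representation of \<open>e\<close> at \<omega> into one at
    \<open>A\<close>.\<close>
  define L' where "L' = P ** L ** P'"
  define R' where "R' = Q' ** R ** Q"
  have tri': "lower_triangular L'" "upper_triangular R'"
    unfolding L'_def R'_def
    by (intro lower_triangular_mult upper_triangular_mult triangular tri)+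
  have LA: "L' ** A = P ** (L ** \<omega>) ** Q"
    unfolding L'_def A_def by (metis P_inverse(2) matrix_mul_assoc matrix_mul_lid)
  have AR: "X ** Q ** R' = X ** R ** Q" for X :: "real^('n::{finite,linorder})^('m::{finite,linorder})"
    unfolding R'_def by (metis Q_inverse(1) matrix_mul_assoc matrix_mul_rid)
  have "e = L' ** A + A ** R'"
    unfolding LA by (simp add: e A_def AR matrix_add_ldistrib matrix_add_rdistrib matrix_mul_assoc)
  then have "outer n \<mu> \<bullet> second_fundamental_form (rank_stratum \<omega>) A e e
      = 2 * (outer n \<mu> \<bullet> (L' ** A ** R'))"
    by (rule inner_second_fundamental_form[OF \<omega> unit_P unit_Q A_def normal_n_\<mu> tri'])
  also have "L' ** A ** R' = P ** (L ** \<omega> ** R) ** Q"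
    by (simp add: LA AR matrix_mul_assoc)
  also have "outer n \<mu> \<bullet> \<dots> = (L ** \<omega> ** R) $ p $ q"
    by (subst inner_commute) (rule inner_n_\<mu>)
  also have "\<dots> = (\<Sum>j\<in>UNIV. \<Sum>k\<in>UNIV. L $ p $ k * \<omega> $ k $ j * R $ j $ q)"
    by (simp add: matrix_mult_nth sum_distrib_right)
  also have "\<dots> = (\<Sum>k\<in>UNIV. \<Sum>j\<in>UNIV. L $ p $ k * \<omega> $ k $ j * R $ j $ q)"
    by (rule sum.swap)
  also have "\<dots> = (\<Sum>(k, j)\<in>UNIV. L $ p $ k * \<omega> $ k $ j * R $ j $ q)"
    by (simp add: sum.cartesian_product)
  also have "\<dots> = (\<Sum>(k, j)\<in>cells. L $ p $ k * \<omega> $ k $ j * R $ j $ q)"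
  proof (rule sum.mono_neutral_right)
    \<comment> \<open>\<open>L $ p $ k\<close> vanishes for \<open>k > p\<close> and
      \<open>R $ j $ q\<close> for \<open>j > q\<close>.\<close>
    show "\<forall>x\<in>UNIV - cells. (case x of (k, j) \<Rightarrow> L $ p $ k * \<omega> $ k $ j * R $ j $ q) = 0"
      using tri partial_permutation_entry[OF \<omega>]
      by (force simp: cells_def lower_triangular_def upper_triangular_def not_le)
  qed auto
  also have "\<dots> = (\<Sum>(k, j)\<in>cells. (e \<bullet> outer n (axis j 1)) * (e \<bullet> outer (axis k 1) \<mu>))"
  proof (rule sum.cong[OF refl], clarify)
    fix k j assume kj: "(k, j) \<in> cells"
    then have le: "k \<le> p" "j \<le> q" and one: "\<omega> $ k $ j = 1" by (auto simp: cells_def)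
    \<comment> \<open>The pairing is the entry \<open>(p, j)\<close> of
      \<open>L ** \<omega> + \<omega> ** R\<close>. Its second summand vanishes since row
      \<open>p\<close> of \<omega> is zero up to column \<open>q\<close>.\<close>
    have "e \<bullet> outer n (axis j 1) = L $ p $ k"
      using cells_less[OF kj] le \<omega>_mult_nth_zero[OF tri(2), of j p] row
      by (simp add: e inner_n_axis mult_\<omega>_nth_one[OF one])
    moreover have "e \<bullet> outer (axis k 1) \<mu> = R $ j $ q"
      using cells_less[OF kj] le mult_\<omega>_nth_zero[OF tri(1), of k q] col
      by (simp add: e inner_axis_\<mu> \<omega>_mult_nth_one[OF one])
    ultimately show "L $ p $ k * \<omega> $ k $ j * R $ j $ q
        = (e \<bullet> outer n (axis j 1)) * (e \<bullet> outer (axis k 1) \<mu>)"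
      by (simp add: one)
  qed
  finally show ?thesis .
qed

text \<open>
  The other summands vanish because the tangent space splits along the rows \<open>{p, i\<^sub>1}\<close> and their
  complement: \<open>outer n (axis j 1)\<close> is supported in the former, \<open>outer (axis k 1) \<mu>\<close> in the latter.
\<close>

lemma restrict_rows_tangent:
  assumes "X \<in> orbit_tangent A"
  shows "restrict_rows {p, i\<^sub>1} X \<in> orbit_tangent A"
proof -
  let ?\<Pi> = "restrict_rows {p, i\<^sub>1}"
  obtain L R where tri: "lower_triangular L" "upper_triangular R"
    and X: "X = P ** (L ** \<omega> + \<omega> ** R) ** Q"
    using assms by (rule orbit_tangent_AE)
  \<comment> \<open>Keeping two rows of \<open>\<omega> ** R\<close> means keeping the rows of
    \<open>R\<close> selected by the ones of \<omega> in these rows.\<close>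
  define R' where "R' = restrict_rows {j. \<omega> $ p $ j = 1 \<or> \<omega> $ i\<^sub>1 $ j = 1} R"
  have "?\<Pi> (\<omega> ** R) $ i $ l = (\<omega> ** R') $ i $ l" for i l
  proof -
    have "(if i \<in> {p, i\<^sub>1} then \<omega> $ i $ j * R $ j $ l else 0) = \<omega> $ i $ j * R' $ j $ l" for j
    proof (cases "\<omega> $ i $ j = 1")
      case True
      then show ?thesis using \<omega>_column[OF True] by (auto simp: R'_def restrict_rows_def)
    next
      case False
      then show ?thesis using partial_permutation_entry[OF \<omega>, of i j] by simp
    qed
    then have "(\<Sum>j\<in>UNIV. if i \<in> {p, i\<^sub>1} then \<omega> $ i $ j * R $ j $ l else 0) = (\<omega> ** R') $ i $ l"
      by (simp add: matrix_mult_nth)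
    then show ?thesis by (auto simp: restrict_rows_def matrix_mult_nth)
  qed
  then have "?\<Pi> (\<omega> ** R) = \<omega> ** R'" by (simp add: vec_eq_iff)
  then have "?\<Pi> (L ** \<omega> + \<omega> ** R) = ?\<Pi> L ** \<omega> + \<omega> ** R'"
    by (simp only: restrict_rows_linear restrict_rows_mult)
  moreover have "lower_triangular (?\<Pi> L)" "upper_triangular R'"
    using tri by (auto simp: lower_triangular_def upper_triangular_def restrict_rows_def R'_def)
  ultimately have "?\<Pi> (L ** \<omega> + \<omega> ** R) \<in> orbit_tangent \<omega>"
    unfolding orbit_tangent_def by blast
  then have "P ** ?\<Pi> (L ** \<omega> + \<omega> ** R) ** Q \<in> orbit_tangent A"
    unfolding A_def by (rule orbit_tangent_translate[OF unit_P unit_Q])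
  \<comment> \<open>\<open>P\<close> only adds row \<open>i\<^sub>1\<close> to row \<open>p\<close>,
    and both are kept.\<close>
  also have "P ** ?\<Pi> Y = ?\<Pi> (P ** Y)" for Y :: "real^('n::{finite,linorder})^('m::{finite,linorder})"
    unfolding vec_eq_iff by (auto simp: restrict_rows_def P_mult_nth)
  also have "?\<Pi> (P ** (L ** \<omega> + \<omega> ** R)) ** Q = ?\<Pi> X"
    by (simp only: X restrict_rows_mult)
  finally show ?thesis .
qed

lemma cell_trace_zero:
  assumes B: "orthonormal_basis_of (orbit_tangent A) B" and k: "k \<noteq> p" "k \<noteq> i\<^sub>1"
  shows "(\<Sum>e\<in>B. (e \<bullet> outer n (axis j 1)) * (e \<bullet> outer (axis k 1) \<mu>)) = 0"
proof -
  let ?T = "orbit_tangent A" and ?\<Pi> = "restrict_rows {p, i\<^sub>1}" and ?X = "outer n (axis j 1) :: real^('n::{finite,linorder})^('m::{finite,linorder})"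
  define X1 where "X1 = ?X - normal_component ?T ?X"
  have "?\<Pi> X1 \<in> ?T"
    unfolding X1_def by (intro restrict_rows_tangent normal_component(2) subspace_orbit_tangent)
  moreover have "?\<Pi> ?X = ?X"
    by (auto simp: vec_eq_iff restrict_rows_def outer_def n_def axis_def)
  then have "?X - ?\<Pi> X1 = ?\<Pi> (normal_component ?T ?X)"
    by (simp add: X1_def restrict_rows_linear)
  \<comment> \<open>The restriction is self-adjoint and preserves the tangent space, hence also its
    complement. So the restricted \<open>X1\<close> is again the tangential part of
    \<open>?X\<close>.\<close>
  then have "?X - ?\<Pi> X1 \<in> orthogonal_comp ?T"
    using normal_component(1)[OF subspace_orbit_tangent, of A ?X] restrict_rows_tangent
    by (auto simp: orthogonal_comp_def orthogonal_def simp flip: inner_restrict_rows)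
  ultimately have "(\<Sum>e\<in>B. (e \<bullet> ?X) * (e \<bullet> outer (axis k 1) \<mu>)) = ?\<Pi> X1 \<bullet> outer (axis k 1) \<mu>"
    by (rule sum_inner_orthonormal_basis[OF B])
  also have "\<dots> = 0"
    using k by (simp add: inner_outer inner_axis' mult_\<mu>) (simp add: restrict_rows_def)
  finally show ?thesis .
qed

lemma cell_trace:
  assumes B: "orthonormal_basis_of (orbit_tangent A) B"
  shows "(\<Sum>e\<in>B. (e \<bullet> outer n (axis b 1)) * (e \<bullet> outer (axis i\<^sub>1 1) \<mu>)) = 1 / 5"
proof -
  \<comment> \<open>\<open>N\<close> spans the normal space modulo normal matrices orthogonal to \<open>outer n (axis b 1)\<close>, and
    \<open>N \<bullet> N = 5\<close>, \<open>N \<bullet> outer n (axis b 1) = - 2\<close>. So \<open>X\<close> is the tangential part of \<open>outer n (axis b 1)\<close>.\<close>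
  define N where "N = outer n \<mu> - unit_matrix i\<^sub>1 a"
  define X where "X = outer n (axis b 1) + (2 / 5) *\<^sub>R N"
  \<comment> \<open>Multiples of rows \<open>i\<^sub>1\<close> and \<open>i\<^sub>2\<close> of
    \<open>A\<close> produce columns \<open>a\<close> and \<open>b\<close> of \<open>X\<close>.
    Column \<open>q\<close> is then short by 1/5 in rows \<open>i\<^sub>1\<close> and
    \<open>p\<close>, exactly where column \<open>b\<close> of \<open>A\<close> has its ones;
    \<open>R\<close> adds this.\<close>
  define L where "L = (- 3 / 5) *\<^sub>R unit_matrix i\<^sub>1 i\<^sub>1 + (3 / 5) *\<^sub>R unit_matrix p i\<^sub>1
    + (- 2 / 5) *\<^sub>R unit_matrix p i\<^sub>2"
  define R where "R = (1 / 5) *\<^sub>R unit_matrix b q"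
  have A_nth: "A $ i\<^sub>1 $ j = (if j = b \<or> j = q then 1 else 0)"
    "A $ i\<^sub>2 $ j = (if j = a \<or> j = q then 1 else 0)"
    "A $ i $ b = (if i = i\<^sub>1 \<or> i = p then 1 else 0)" for i j
    using distinct by (auto simp: A_def mult_Q_nth P_mult_nth \<omega>_row[OF ones(1)] \<omega>_row[OF ones(2)] \<omega>_column[OF ones(1)])
  have X_nth: "X $ i $ j = ((if i = p then 1 else 0) - (if i = i\<^sub>1 then 1 else 0)) *
      ((if j = b then 1 else 0) + 2 / 5 * ((if j = q then 1 else 0) - (if j = b then 1 else 0)
        - (if j = a then 1 else 0))) - 2 / 5 * (if i = i\<^sub>1 \<and> j = a then 1 else 0)" for i j
    by (simp add: X_def N_def outer_def n_def \<mu>_def axis_def unit_matrix_nth algebra_simps)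
  have "lower_triangular L" "upper_triangular R"
    unfolding L_def R_def using order
    by (intro lower_triangular_linear upper_triangular_linear lower_triangular_unit_matrix
        upper_triangular_unit_matrix; simp)+
  moreover have "X = L ** A + A ** R"
  proof -
    have LA: "(L ** A) $ i $ j = - 3 / 5 * (if i = i\<^sub>1 then A $ i\<^sub>1 $ j else 0)
        + 3 / 5 * (if i = p then A $ i\<^sub>1 $ j else 0) + - 2 / 5 * (if i = p then A $ i\<^sub>2 $ j else 0)"
      and AR: "(A ** R) $ i $ j = 1 / 5 * (if j = q then A $ i $ b else 0)" for i j
      by (simp_all only: L_def R_def matrix_add_rdistrib matrix_scaleR_mult vector_add_component
          vector_scaleR_component real_scaleR_def unit_matrix_mult_nth mult_unit_matrix_nth)
    then show ?thesis unfolding vec_eq_iff X_nth vector_add_component LA AR A_nth using distinct by auto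
  qed
  ultimately have "X \<in> orbit_tangent A" unfolding orbit_tangent_def by blast
  moreover have "outer n (axis b 1) - X = (- 2 / 5) *\<^sub>R N" by (simp add: X_def)
  moreover have "N \<in> orthogonal_comp (orbit_tangent A)"
    unfolding N_def by (intro subspace_diff subspace_orthogonal_comp normal_n_\<mu> normal_unit_matrix)
  then have "(- 2 / 5) *\<^sub>R N \<in> orthogonal_comp (orbit_tangent A)"
    by (rule subspace_scale[OF subspace_orthogonal_comp])
  ultimately have "(\<Sum>e\<in>B. (e \<bullet> outer n (axis b 1)) * (e \<bullet> outer (axis i\<^sub>1 1) \<mu>))
      = X \<bullet> outer (axis i\<^sub>1 1) \<mu>"
    by (intro sum_inner_orthonormal_basis[OF B]) simp_all
  \<comment> \<open>Row \<open>i\<^sub>1\<close> of \<open>X\<close> has entries -2/5, -3/5 and 0 in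
    columns \<open>q\<close>, \<open>b\<close> and \<open>a\<close>.\<close>
  also have "\<dots> = 1 / 5"
    using distinct by (simp add: inner_outer inner_axis' mult_\<mu> X_nth)
  finally show ?thesis .
qed

lemma mean_curvature_nonzero: "mean_curvature_vector (rank_stratum \<omega>) A \<noteq> 0"
proof -
  let ?M = "rank_stratum \<omega>"
  obtain B where B: "orthonormal_basis_of (orbit_tangent A) B"
    and H: "mean_curvature_vector ?M A = (\<Sum>e\<in>B. second_fundamental_form ?M A e e)"
    using mean_curvature_vector_basis[of ?M A] subspace_orbit_tangent
    unfolding tangent_space_A by blast
  have BT: "e \<in> orbit_tangent A" if "e \<in> B" for e
    using B that span_base unfolding orthonormal_basis_of_def by blast
  have "outer n \<mu> \<bullet> mean_curvature_vector ?M A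
      = (\<Sum>e\<in>B. 2 * (\<Sum>(k, j)\<in>cells. (e \<bullet> outer n (axis j 1)) * (e \<bullet> outer (axis k 1) \<mu>)))"
    unfolding H inner_sum_right
    by (intro sum.cong refl inner_second_fundamental_form_cells BT)
  also have "\<dots> = 2 * (\<Sum>(k, j)\<in>cells. \<Sum>e\<in>B. (e \<bullet> outer n (axis j 1)) * (e \<bullet> outer (axis k 1) \<mu>))"
    by (simp add: sum_distrib_left[symmetric] sum.swap[of _ cells B] case_prod_unfold)
  also have "(\<Sum>(k, j)\<in>cells. \<Sum>e\<in>B. (e \<bullet> outer n (axis j 1)) * (e \<bullet> outer (axis k 1) \<mu>))
      = (\<Sum>(k, j)\<in>{(i\<^sub>1, b)}. \<Sum>e\<in>B. (e \<bullet> outer n (axis j 1)) * (e \<bullet> outer (axis k 1) \<mu>))"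
  proof (rule sum.mono_neutral_right)
    show "{(i\<^sub>1, b)} \<subseteq> cells" using order ones by (auto simp: cells_def)
    show "\<forall>x\<in>cells - {(i\<^sub>1, b)}. (case x of (k, j) \<Rightarrow>
      \<Sum>e\<in>B. (e \<bullet> outer n (axis j 1)) * (e \<bullet> outer (axis k 1) \<mu>)) = 0"
    proof
      fix x assume x: "x \<in> cells - {(i\<^sub>1, b)}"
      obtain k j where kj: "x = (k, j)" by force
      \<comment> \<open>Row \<open>i\<^sub>1\<close> has its only one in column \<open>b\<close>, so
        any other cell lies in another row.\<close>
      then have "k \<noteq> i\<^sub>1"
        using x \<omega>_row[OF ones(1), of j] by (auto simp: cells_def split: if_splits)
      moreover have "k \<noteq> p" using x kj cells_less by blast
      ultimately show "(case x of (k, j) \<Rightarrow>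
          \<Sum>e\<in>B. (e \<bullet> outer n (axis j 1)) * (e \<bullet> outer (axis k 1) \<mu>)) = 0"
        using cell_trace_zero[OF B] by (simp add: kj)
    qed
  qed auto
  also have "\<dots> = 1 / 5" using cell_trace[OF B] by simp
  finally show ?thesis by auto
qed

end

theorem theorem1:
  fixes \<omega> :: "real^('n::{finite,linorder})^('m::{finite,linorder})"
  assumes "partial_permutation \<omega>"
    and "\<not> vexillary \<omega>"
  shows "\<exists>A\<in>rank_stratum \<omega>. mean_curvature_vector (rank_stratum \<omega>) A \<noteq> 0"
proof -
  obtain i\<^sub>1 i\<^sub>2 p a b q where "nonvexillary_pattern \<omega> i\<^sub>1 i\<^sub>2 p a b q"
    using nonvexillaryE[OF assms] assms(1) unfolding nonvexillary_pattern_def by metis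
  then interpret nonvexillary_pattern \<omega> i\<^sub>1 i\<^sub>2 p a b q .
  show ?thesis using A_in_stratum mean_curvature_nonzero by blast
qed

end
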